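(* Let $\boldsymbol{y}=\boldsymbol{X}\boldsymbol{\beta}^*+\boldsymbol{\epsilon}$ be the sub-Gaussian linear model described in the context, with $k^*$ the number of non-zero entries of $\boldsymbol{\beta}^*$, and $G,s^*,m^*$ the group quantities defined there. Let $\delta\in(0,\tfrac12)$ and $\alpha\ge2$. Below, $\lesssim$ denotes inequality up to a universal multiplicative constant. (1) (Lasso) Assume $\|\boldsymbol{X}_j\|_2\le\sqrt n$ for every column $\boldsymbol{X}_j$, $j=1,\dots,p$, and that there is a constant $\kappa^*$ such that, almost surely, $$0<\kappa^*\le\inf_{|S|\le k^*}\ \inf_{\boldsymbol{z}\in\Lambda\left(S,\frac{\alpha}{\alpha-1},\frac{\sqrt{k^*}}{\alpha-1}\right),\ \boldsymbol{z}\ne0}\ \frac{\boldsymbol{z}^T\boldsymbol{X}^T\boldsymbol{X}\boldsymbol{z}}{n\|\boldsymbol{z}\|_2^2}.$$ Let $\hat{\boldsymbol{\beta}}_1$ be a solution of $$\min_{\boldsymbol{\beta}\in\mathbb{R}^p}\ \frac1n\|\boldsymbol{y}-\boldsymbol{X}\boldsymbol{\beta}\|_2^2+\lambda\|\boldsymbol{\beta}\|_1,\qquad \lambda=24\,\alpha\,\sigma\sqrt{n^{-1}\log(2pe/k^* )\,\log(1/\delta)}.$$ Then, with probability at least $1-\delta$, $$\|\hat{\boldsymbol{\beta}}_1-\boldsymbol{\beta}^*\|_2\lesssim\frac{\alpha\sigma}{\kappa^*}\sqrt{\frac{k^*\log(p/k^* )\log(1/\delta)}{n}}.$$ (2) (Group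 Lasso) Assume that almost surely $\sup_{g=1,\dots,G}\mu_{\max}(\boldsymbol{X}_g^T\boldsymbol{X}_g)\le n$, that the total size $m_0$ of the $s^*$ largest groups satisfies $m_0\le\gamma m^*$ for some $\gamma\ge1$, and that there is a constant $\kappa^*$ such that, almost surely, $$0<\kappa^*\le\inf_{|\mathcal{J}|\le s^*}\ \inf_{\boldsymbol{z}\in\Omega\left(\mathcal{J},\frac{\alpha}{\alpha-1},\frac{\sqrt{s^*}}{\alpha-1}\right),\ \boldsymbol{z}\ne0}\ \frac{\boldsymbol{z}^T\boldsymbol{X}^T\boldsymbol{X}\boldsymbol{z}}{n\|\boldsymbol{z}\|_2^2}.$$ Let $\hat{\boldsymbol{\beta}}_{L1-L2}$ be a solution of $$\min_{\boldsymbol{\beta}\in\mathbb{R}^p}\ \frac1n\|\boldsymbol{y}-\boldsymbol{X}\boldsymbol{\beta}\|_2^2+\lambda_G\sum_{g=1}^G\|\boldsymbol{\beta}_g\|_2,\qquad \lambda_G=24\,\alpha\,\sigma\sqrt{n^{-1}\log(2Ge/s^* )\,\log(2/\delta)}+4\,\alpha\,\sigma\sqrt{n^{-1}\gamma\,(s^* )^{-1}m^*}.$$ Then, with probability at least $1-\delta$, $$\|\hat{\boldsymbol{\beta}}_{L1-L2}-\boldsymbol{\beta}^*\|_2\lesssim\frac{\alpha\sigma}{\kappa^*}\sqrt{\frac{s^*\log(G/s^* )\log(1/\delta)+\gamma m^*}{n}}.$$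
   Context: Model: $\boldsymbol{y}=\boldsymbol{X}\boldsymbol{\beta}^*+\boldsymbol{\epsilon}$ with $\boldsymbol{y}\in\mathbb{R}^n$, model matrix $\boldsymbol{X}\in\mathbb{R}^{n\times p}$, ground truth $\boldsymbol{\beta}^*\in\mathbb{R}^p$ with $k^*$ non-zero entries, and $\boldsymbol{\epsilon}=(\epsilon_1,\dots,\epsilon_n)$ whose entries are independent realizations of a sub-Gaussian random variable with variance (proxy) $\sigma^2$, i.e. $\mathbb{E}\,\epsilon_i=0$ and $\mathbb{E}\exp(t\epsilon_i)\le\exp(\sigma^2t^2/2)$ for all $t\in\mathbb{R}$. In the formulas for $\lambda,\lambda_G$, $e=\exp(1)$. Groups: the coefficient indexes $\{1,\dots,p\}$ are split into known disjoint groups $\mathcal{I}_1,\dots,\mathcal{I}_G$, with sizes $n_g=|\mathcal{I}_g|$. For $\boldsymbol{z}\in\mathbb{R}^p$, $\boldsymbol{z}_g$ is the restriction of $\boldsymbol{z}$ to $\mathcal{I}_g$, and $\boldsymbol{z}_S$ its restriction to an index set $S$. $\boldsymbol{X}_g\in\mathbb{R}^{n\times n_g}$ is the restriction of $\boldsymbol{X}$ to the columns in $\mathcal{I}_g$, and $\mu_{\max}$ denotes the highest eigenvalue. $\mathcal{J}^*\subset\{1,\dots,G\}$ is the smallest subset of group indexes such that the support of $\boldsymbol{\beta}^*$ is included in the union of these groups; $s^*=|\mathcal{J}^*|$; $m^*$ is the sum of the sizes of these $s^*$ groups. Cones: for $S\subset\{1,\dots,p\}$ and $\gamma_1,\gamma_2>0$,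 $$\Lambda(S,\gamma_1,\gamma_2)=\{\boldsymbol{z}\in\mathbb{R}^p:\ \|\boldsymbol{z}_{S^c}\|_1\le\gamma_1\|\boldsymbol{z}_S\|_1+\gamma_2\|\boldsymbol{z}_S\|_2\}.$$ For $\mathcal{J}\subset\{1,\dots,G\}$, $\mathcal{T}(\mathcal{J})=\cup_{g\in\mathcal{J}}\mathcal{I}_g$, and $\epsilon_1,\epsilon_2>0$ (scalars unrelated to the noise), $$\Omega(\mathcal{J},\epsilon_1,\epsilon_2)=\Big\{\boldsymbol{z}\in\mathbb{R}^p:\ \sum_{g\notin\mathcal{J}}\|\boldsymbol{z}_g\|_2\le\epsilon_1\sum_{g\in\mathcal{J}}\|\boldsymbol{z}_g\|_2+\epsilon_2\|\boldsymbol{z}_{\mathcal{T}(\mathcal{J})}\|_2\Big\}.$$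
   Formalization: The displayed bounds fail when k* is close to p or s* close to G (for k* = p the first is 0), so they are proved for 2k* ≤ p and 2s* ≤ G; in general they are proved with log(2pe/k* ) and log(2Ge/s* ). β* ≠ 0, σ > 0, nonempty groups, and X independent of the noise are assumed. *)

theory Defs
  imports "HOL-Probability.Probability"
begin

text \<open>Coordinate restrictions are zero-padded to the full space, so that all vectors
  share one type; their norms agree with those of the actual subvectors.\<close>

definition restr :: "'p::finite set \<Rightarrow> real^'p \<Rightarrow> real^'p" where
  "restr S z = (\<chi> j. if j \<in> S then z $ j else 0)"

definition restr_cols :: "'p::finite set \<Rightarrow> real^'p^'n \<Rightarrow> real^'p^'n" where
  "restr_cols S X = (\<chi> i j. if j \<in> S then X $ i $ j else 0)"

definition l1_norm :: "real^'p::finite \<Rightarrow> real" where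
  "l1_norm z = (\<Sum>j\<in>UNIV. \<bar>z $ j\<bar>)"

definition supp :: "real^'p::finite \<Rightarrow> 'p set" where
  "supp b = {j. b $ j \<noteq> 0}"


text \<open>The sub-Gaussian linear model. The design may be random, independently of the noise;
  a deterministic design is a constant (hence independent) random matrix. The library's
  \<open>indep_var\<close> needs both variables to have the same type, so independence of design and noise
  is expressed by independence of the events they generate.\<close>

definition sub_gaussian :: "'w measure \<Rightarrow> real \<Rightarrow> ('w \<Rightarrow> real) \<Rightarrow> bool" where
  "sub_gaussian M \<sigma> Z \<longleftrightarrow>
     Z \<in> borel_measurable M \<and>
     integrable M Z \<and> (\<integral>\<omega>. Z \<omega> \<partial>M) = 0 \<and>
     (\<forall>t::real. integrable M (\<lambda>\<omega>. exp (t * Z \<omega>)) \<and>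
               (\<integral>\<omega>. exp (t * Z \<omega>) \<partial>M) \<le> exp (\<sigma>\<^sup>2 * t\<^sup>2 / 2))"

definition sub_gaussian_linear_model ::
  "'w measure \<Rightarrow> ('w \<Rightarrow> real^'p::finite^'n::finite) \<Rightarrow> ('w \<Rightarrow> real^'n) \<Rightarrow> real^'p \<Rightarrow>
     ('w \<Rightarrow> real^'n) \<Rightarrow> real \<Rightarrow> bool" where
  "sub_gaussian_linear_model M X y \<beta> \<epsilon> \<sigma> \<longleftrightarrow>
     prob_space M \<and>
     X \<in> borel_measurable M \<and> \<epsilon> \<in> borel_measurable M \<and>
     prob_space.indep_set M {X -` A \<inter> space M | A. A \<in> sets borel}
                            {\<epsilon> -` B \<inter> space M | B. B \<in> sets borel} \<and>
     prob_space.indep_vars M (\<lambda>_. borel) (\<lambda>i \<omega>. \<epsilon> \<omega> $ i) UNIV \<and>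
     (\<forall>i j. distr M borel (\<lambda>\<omega>. \<epsilon> \<omega> $ i) = distr M borel (\<lambda>\<omega>. \<epsilon> \<omega> $ j)) \<and>
     (\<forall>i. sub_gaussian M \<sigma> (\<lambda>\<omega>. \<epsilon> \<omega> $ i)) \<and>
     (\<forall>\<omega>\<in>space M. y \<omega> = X \<omega> *v \<beta> + \<epsilon> \<omega>)"

text \<open>Stated through an event, so that it makes sense for solutions of the optimization
  problems that are not known to depend measurably on the sample point.\<close>

definition with_prob_at_least :: "'w measure \<Rightarrow> real \<Rightarrow> ('w \<Rightarrow> bool) \<Rightarrow> bool" where
  "with_prob_at_least M q P \<longleftrightarrow> (\<exists>E\<in>sets M. q \<le> measure M E \<and> (\<forall>\<omega>\<in>E. P \<omega>))"

text \<open>Inequality up to a universal constant. The constant is a fixed number, because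
  an existential quantifier inside a theorem with type variables would allow it to depend on
  those types, that is, on the dimensions and on the sample space.\<close>

definition lesssim :: "real \<Rightarrow> real \<Rightarrow> bool" (infix "\<lesssim>" 50) where
  "a \<lesssim> b \<longleftrightarrow> a \<le> 1000 * b"


definition group_partition :: "('g::finite \<Rightarrow> 'p::finite set) \<Rightarrow> bool" where
  "group_partition I \<longleftrightarrow> (\<forall>g. I g \<noteq> {}) \<and> disjoint_family I \<and> (\<Union>g. I g) = UNIV"

text \<open>\<open>LEAST\<close> refers to the inclusion order on sets of group indexes.\<close>

definition active_groups :: "('g::finite \<Rightarrow> 'p::finite set) \<Rightarrow> real^'p \<Rightarrow> 'g set" where
  "active_groups I \<beta> = (LEAST J. supp \<beta> \<subseteq> (\<Union>g\<in>J. I g))"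

definition total_size :: "('g::finite \<Rightarrow> 'p::finite set) \<Rightarrow> 'g set \<Rightarrow> nat" where
  "total_size I J = (\<Sum>g\<in>J. card (I g))"

text \<open>The total size of the \<open>s\<close> largest groups, for \<open>s\<close> at most the number of groups.\<close>

definition largest_total_size :: "('g::finite \<Rightarrow> 'p::finite set) \<Rightarrow> nat \<Rightarrow> nat" where
  "largest_total_size I s = Max (total_size I ` {J. card J = s})"

text \<open>The eigenvalues of \<open>X\<^sub>S\<^sup>T X\<^sub>S\<close> as a matrix indexed by \<open>S \<times> S\<close>: requiring the eigenvector
  to be supported in \<open>S\<close> removes the spurious eigenvalue 0 of the zero-padded matrix.\<close>

definition gram_eigenvalues :: "real^'p::finite^'n::finite \<Rightarrow> 'p set \<Rightarrow> real set" where
  "gram_eigenvalues X S =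
     {\<mu>. \<exists>v. v \<noteq> 0 \<and> restr S v = v \<and>
             (transpose (restr_cols S X) ** restr_cols S X) *v v = \<mu> *\<^sub>R v}"

definition mu_max :: "real^'p::finite^'n::finite \<Rightarrow> 'p set \<Rightarrow> real" where
  "mu_max X S = Max (gram_eigenvalues X S)"


definition Lambda_cone :: "'p::finite set \<Rightarrow> real \<Rightarrow> real \<Rightarrow> (real^'p) set" where
  "Lambda_cone S \<gamma>1 \<gamma>2 =
     {z. l1_norm (restr (- S) z) \<le> \<gamma>1 * l1_norm (restr S z) + \<gamma>2 * norm (restr S z)}"

definition Omega_cone ::
  "('g::finite \<Rightarrow> 'p::finite set) \<Rightarrow> 'g set \<Rightarrow> real \<Rightarrow> real \<Rightarrow> (real^'p) set" where
  "Omega_cone I J e1 e2 =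
     {z. (\<Sum>g\<in>- J. norm (restr (I g) z))
           \<le> e1 * (\<Sum>g\<in>J. norm (restr (I g) z)) + e2 * norm (restr (\<Union>g\<in>J. I g) z)}"

definition rayleigh :: "real^'p::finite^'n::finite \<Rightarrow> real^'p \<Rightarrow> real" where
  "rayleigh X z = (z \<bullet> ((transpose X ** X) *v z)) / (real CARD('n) * (norm z)\<^sup>2)"

text \<open>The infima are taken in the extended reals, where the infimum over an empty set is
  infinite: for instance the cone of \<open>S = {}\<close> contains no nonzero vector.\<close>

definition lasso_RE :: "real^'p::finite^'n::finite \<Rightarrow> nat \<Rightarrow> real \<Rightarrow> real \<Rightarrow> ereal" where
  "lasso_RE X k \<gamma>1 \<gamma>2 =
     (INF S\<in>{S. card S \<le> k}. INF z\<in>{z \<in> Lambda_cone S \<gamma>1 \<gamma>2. z \<noteq> 0}. ereal (rayleigh X z))"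

definition group_RE ::
  "real^'p::finite^'n::finite \<Rightarrow> ('g::finite \<Rightarrow> 'p set) \<Rightarrow> nat \<Rightarrow> real \<Rightarrow> real \<Rightarrow> ereal" where
  "group_RE X I s e1 e2 =
     (INF J\<in>{J. card J \<le> s}. INF z\<in>{z \<in> Omega_cone I J e1 e2. z \<noteq> 0}. ereal (rayleigh X z))"


definition lasso_objective ::
  "real^'p::finite^'n::finite \<Rightarrow> real^'n \<Rightarrow> real \<Rightarrow> real^'p \<Rightarrow> real" where
  "lasso_objective X y l b = (norm (y - X *v b))\<^sup>2 / real CARD('n) + l * l1_norm b"

definition group_lasso_objective ::
  "real^'p::finite^'n::finite \<Rightarrow> ('g::finite \<Rightarrow> 'p set) \<Rightarrow> real^'n \<Rightarrow> real \<Rightarrow> real^'p \<Rightarrow> real" where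
  "group_lasso_objective X I y l b =
     (norm (y - X *v b))\<^sup>2 / real CARD('n) + l * (\<Sum>g\<in>UNIV. norm (restr (I g) b))"

end

theory Submission
  imports Defs
begin

text \<open>The Lasso is the group Lasso of the singleton groups, so both parts are instances of one
  bound. Let \<open>h = \<beta>hat - \<beta>\<close>, let \<open>J\<close> be the \<open>s\<close> groups on which \<open>h\<close> is largest, and let
  \<open>e\<^sub>g = \<parallel>(X\<^sup>T \<epsilon>)\<^sub>g\<parallel>\<close>. If every set of \<open>s\<close> groups satisfies \<open>\<Sum> e\<^sub>g\<^sup>2 \<le> s (4N/5)\<^sup>2\<close>, then
  \<open>\<epsilon>\<^sup>T X h \<le> N (\<surd>s \<parallel>h\<^sub>J\<parallel> + \<Sum>\<^bsub>g \<notin> J\<^esub> \<parallel>h\<^sub>g\<parallel>)\<close>, and comparing the objective at the minimiser and at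
  the truth puts \<open>h\<close> into the cone of the restricted eigenvalue condition and bounds its norm.

  The condition on the noise holds with probability at least \<open>1 - \<delta>\<close>: given \<open>X\<close>,
  \<open>exp (3 e\<^sub>g\<^sup>2 / (8 \<sigma>\<^sup>2 n))\<close> has mean at most \<open>2 ^ n\<^sub>g\<close>. Rescaled by \<open>2 ^ n\<^sub>g\<close>, they have mean at most
  1, so by Markov their sum over all \<open>G\<close> groups is at most \<open>G / \<delta>\<close>, and Jensen's inequality for the
  average over any \<open>s\<close> groups gives \<open>\<Sum> e\<^sub>g\<^sup>2 \<le> 8/3 \<sigma>\<^sup>2 n (s ln (G / (s \<delta>)) + ln 2 \<Sum> n\<^sub>g)\<close> at once for
  all of them, without a union bound.\<close>

subsection \<open>Sums over the largest entries\<close>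

text \<open>Greedy construction: a largest remaining entry is added \<open>s\<close> times. The
  threshold \<open>\<tau>\<close> is the least entry on \<open>J\<close>; being a value of
  \<open>a\<close>, it inherits the sign of the entries.\<close>

lemma ex_top_set:
  fixes a :: "'g::finite \<Rightarrow> real"
  assumes "s \<le> CARD('g)" "0 < s"
  obtains J \<tau> where "card J = s" "\<tau> \<in> range a" "\<And>j. j \<in> J \<Longrightarrow> \<tau> \<le> a j" "\<And>g. g \<notin> J \<Longrightarrow> a g \<le> \<tau>"
proof -
  have "\<exists>J. card J = s \<and> (\<forall>j\<in>J. \<forall>g\<in>-J. a g \<le> a j)"
    using assms(1)
  proof (induction s)
    case 0
    show ?case by (intro exI[of _ "{}"]) simp
  next
    case (Suc s)
    then obtain J where J: "card J = s" "\<forall>j\<in>J. \<forall>g\<in>-J. a g \<le> a j" by auto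
    have ne: "- J \<noteq> {}"
    proof
      assume "- J = {}"
      then have "J = UNIV" by auto
      with J Suc.prems show False by simp
    qed
    have "Max (a ` (-J)) \<in> a ` (-J)" using ne by (intro Max_in) auto
    then obtain x where x: "x \<in> -J" "a x = Max (a ` (-J))" by auto
    have x2: "a g \<le> a x" if "g \<in> -J" for g using that unfolding x(2) by (intro Max_ge) auto
    show ?case using J x x2 by (intro exI[of _ "insert x J"]) auto
  qed
  then obtain J where J: "card J = s" "\<forall>j\<in>J. \<forall>g\<in>-J. a g \<le> a j" by blast
  have "J \<noteq> {}" using J assms by auto
  then have min: "Min (a ` J) \<in> a ` J" by (intro Min_in) auto
  show ?thesis
  proof (rule that[of J "Min (a ` J)"])
    show "Min (a ` J) \<in> range a" using min by auto
    show "Min (a ` J) \<le> a j" if "j \<in> J" for j using that by (intro Min_le) auto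
    show "a g \<le> Min (a ` J)" if "g \<notin> J" for g using J(2) min that by auto
  qed (use J in auto)
qed

text \<open>The sets \<open>K - J\<close> and \<open>J - K\<close> have the same size, and
  \<open>\<tau>\<close> separates the entries on them.\<close>

lemma sum_le_sum_top:
  fixes a :: "'g::finite \<Rightarrow> real"
  assumes "card K = card J" "\<And>j. j \<in> J \<Longrightarrow> \<tau> \<le> a j" "\<And>g. g \<notin> J \<Longrightarrow> a g \<le> \<tau>"
  shows "sum a K \<le> sum a J"
proof -
  have "card (K - J) = card (J - K)"
    using assms(1) card_Diff_subset_Int[of K J] card_Diff_subset_Int[of J K] by (simp add: Int_commute)
  moreover have "sum a (K - J) \<le> real (card (K - J)) * \<tau>"
    using assms(3) by (intro sum_bounded_above) auto
  moreover have "real (card (J - K)) * \<tau> \<le> sum a (J - K)"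
    using assms(2) by (intro sum_bounded_below) auto
  moreover have "sum a K = sum a (K \<inter> J) + sum a (K - J)" "sum a J = sum a (K \<inter> J) + sum a (J - K)"
    by (simp_all add: sum.Int_Diff[of K a J] sum.Int_Diff[of J a K] Int_commute)
  ultimately show ?thesis by simp
qed

text \<open>The bound on sums of squares leaves at most \<open>s\<close> entries of \<open>e\<close>
  above \<open>N\<close>. Their excess outside \<open>J\<close> is charged to the norm of
  \<open>a\<close> on \<open>J\<close>: outside, \<open>a\<close> is at most \<open>\<tau>\<close>,
  while all \<open>s\<close> entries on \<open>J\<close> are at least \<open>\<tau>\<close>.
  Cauchy-Schwarz on \<open>J\<close> uses up only \<open>4/5\<close> of the coefficient, which
  leaves room for this charge.\<close>

lemma sum_mult_le_top:
  fixes a e :: "'g::finite \<Rightarrow> real"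
  assumes a: "\<And>g. 0 \<le> a g" and e: "\<And>g. 0 \<le> e g" and s: "card J = s" "0 < s"
    and top: "0 \<le> \<tau>" "\<And>j. j \<in> J \<Longrightarrow> \<tau> \<le> a j" "\<And>g. g \<notin> J \<Longrightarrow> a g \<le> \<tau>"
    and N: "0 < N" "\<And>K. card K = s \<Longrightarrow> (\<Sum>g\<in>K. (e g)\<^sup>2) \<le> real s * (4/5 * N)\<^sup>2"
  shows "(\<Sum>g\<in>UNIV. a g * e g) \<le> N * (sqrt s * L2_set a J + sum a (- J))"
proof -
  define B where "B = {g \<in> - J. N < e g}"
  have "s \<le> CARD('g)" using s card_mono[of UNIV J] by simp
  have cB: "card B \<le> s"
  proof (rule ccontr)
    assume "\<not> card B \<le> s"
    then obtain K where K: "K \<subseteq> B" "card K = s" by (metis ex_card nat_le_linear)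
    have "real (card K) * N\<^sup>2 \<le> (\<Sum>g\<in>K. (e g)\<^sup>2)"
      using K(1) N(1) by (intro sum_bounded_below power_mono) (auto simp: B_def)
    also have "\<dots> \<le> real s * (4/5 * N)\<^sup>2" using N(2) K by blast
    finally show False using K s N(1) by (simp add: power_mult_distrib power2_eq_square)
  qed
  \<comment> \<open>The hypothesis on \<open>e\<close> speaks of sets of exactly \<open>s\<close>
    indices, so \<open>B\<close> is enlarged to such a set.\<close>
  obtain K where K: "B \<subseteq> K" "card K = s"
    using exists_subset_between[OF cB \<open>s \<le> CARD('g)\<close>] by auto
  have B2: "(\<Sum>g\<in>B. (e g)\<^sup>2) \<le> real s * (4/5 * N)\<^sup>2"
    using sum_mono2[of K B "\<lambda>g. (e g)\<^sup>2"] K N(2)[of K] by fastforce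
  have tau: "sqrt s * \<tau> \<le> L2_set a J"
  proof -
    have "(sqrt s * \<tau>)\<^sup>2 = real (card J) * \<tau>\<^sup>2" using s by (simp add: power_mult_distrib)
    also have "\<dots> \<le> (\<Sum>j\<in>J. (a j)\<^sup>2)" using top by (intro sum_bounded_below power_mono) auto
    finally show ?thesis unfolding L2_set_def by (rule real_le_rsqrt)
  qed
  have "(\<Sum>g\<in>J. a g * e g) \<le> L2_set a J * L2_set e J"
    using L2_set_mult_ineq[of a e J] a e by simp
  also have "\<dots> \<le> L2_set a J * sqrt (real s * (4/5 * N)\<^sup>2)"
    using N(2)[OF s(1)] by (intro mult_left_mono) (simp_all add: L2_set_def sum_nonneg)
  also have "\<dots> = L2_set a J * (sqrt s * (4/5 * N))" using N(1) by (simp add: real_sqrt_mult)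
  finally have 1: "(\<Sum>g\<in>J. a g * e g) \<le> 4/5 * N * (sqrt s * L2_set a J)"
    by (simp only: mult_ac)
  have "(\<Sum>g\<in>-J. a g * e g) \<le> (\<Sum>g\<in>-J. N * a g + (if g \<in> B then \<tau> * ((e g)\<^sup>2 / (4 * N)) else 0))"
  proof (rule sum_mono)
    fix g assume g: "g \<in> - J"
    show "a g * e g \<le> N * a g + (if g \<in> B then \<tau> * ((e g)\<^sup>2 / (4 * N)) else 0)"
    proof (cases "g \<in> B")
      case True
      \<comment> \<open>This square turns the excess \<open>e g - N\<close> into a multiple of the
        square of \<open>e g\<close>, whose sum over \<open>B\<close> is controlled.\<close>
      have "0 \<le> (e g - 2 * N)\<^sup>2" by simp
      then have "e g - N \<le> (e g)\<^sup>2 / (4 * N)"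
        using N(1) by (simp add: field_simps power2_eq_square)
      moreover have "0 \<le> e g - N" using True by (simp add: B_def)
      ultimately have "a g * (e g - N) \<le> \<tau> * ((e g)\<^sup>2 / (4 * N))"
        using top(1) top(3)[of g] g by (intro mult_mono) auto
      then show ?thesis using True by (simp add: algebra_simps)
    next
      case False
      then have "e g \<le> N" using g by (auto simp: B_def)
      then show ?thesis using a[of g] False mult_left_mono[of "e g" N "a g"] by (simp add: mult.commute)
    qed
  qed
  also have "\<dots> = N * sum a (-J) + \<tau> / (4 * N) * (\<Sum>g\<in>B. (e g)\<^sup>2)"
  proof -
    have "(\<Sum>g\<in>-J. (if g \<in> B then \<tau> * ((e g)\<^sup>2 / (4 * N)) else 0)) = (\<Sum>g\<in>B. \<tau> * ((e g)\<^sup>2 / (4 * N)))"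
      by (rule sum.mono_neutral_cong_right) (auto simp: B_def)
    then show ?thesis by (simp add: sum.distrib sum_distrib_left)
  qed
  also have "\<tau> / (4 * N) * (\<Sum>g\<in>B. (e g)\<^sup>2) \<le> \<tau> / (4 * N) * (real s * (4/5 * N)\<^sup>2)"
    using B2 top(1) N(1) by (intro mult_left_mono) auto
  \<comment> \<open>The factor is one quarter of the square of \<open>4/5\<close>; \<open>s\<close>
    is split into two roots so that \<open>tau\<close> applies.\<close>
  also have "\<dots> = 4/25 * N * (sqrt s * (sqrt s * \<tau>))"
  proof -
    have "sqrt s * (sqrt s * \<tau>) = real s * \<tau>"
      by (metis mult.assoc real_sqrt_mult_self abs_of_nat)
    then show ?thesis using N(1) by (simp add: power2_eq_square)
  qed
  also have "\<dots> \<le> 4/25 * N * (sqrt s * L2_set a J)"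
    using tau N(1) by (intro mult_left_mono) auto
  finally have 2: "(\<Sum>g\<in>-J. a g * e g) \<le> N * sum a (-J) + 4/25 * N * (sqrt s * L2_set a J)" by simp
  have "0 \<le> N * (sqrt s * L2_set a J)" using N(1) by (simp add: L2_set_nonneg)
  moreover have "(\<Sum>g\<in>UNIV. a g * e g) = (\<Sum>g\<in>J. a g * e g) + (\<Sum>g\<in>-J. a g * e g)"
    using sum.subset_diff[of J UNIV "\<lambda>g. a g * e g"] by (simp add: Compl_eq_Diff_UNIV)
  \<comment> \<open>The two contributions add up to \<open>4/5 + 4/25 = 24/25\<close>, below
    1.\<close>
  ultimately show ?thesis using 1 2 by (simp add: algebra_simps)
qed

subsection \<open>Deterministic error bound\<close>

lemma restr_nth [simp]: "restr S z $ j = (if j \<in> S then z $ j else 0)"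
  by (simp add: restr_def)

lemma linear_restr: "linear (restr S)"
  by (rule linearI) (auto simp: vec_eq_iff)

lemma restr_restr: "restr S (restr T z) = restr (S \<inter> T) z"
  by (simp add: vec_eq_iff)

lemma inner_restr: "x \<bullet> restr S y = (\<Sum>j\<in>S. x $ j * y $ j)"
proof -
  have "(\<Sum>j\<in>UNIV. x $ j * (if j \<in> S then y $ j else 0)) = (\<Sum>j\<in>S. x $ j * y $ j)"
    by (rule sum.mono_neutral_cong_right) auto
  then show ?thesis by (simp add: inner_vec_def)
qed

lemma inner_restr_left: "restr S x \<bullet> y = x \<bullet> restr S y"
  by (simp add: inner_restr inner_commute[of _ y] mult.commute)

lemma inner_restr_restr: "restr S x \<bullet> restr S y = (\<Sum>j\<in>S. x $ j * y $ j)"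
  unfolding inner_restr_left restr_restr by (simp add: inner_restr)

lemma norm_restr_sq: "(norm (restr S z))\<^sup>2 = (\<Sum>j\<in>S. (z $ j)\<^sup>2)"
  unfolding power2_norm_eq_inner inner_restr_restr by (simp add: power2_eq_square)

lemma norm_restr_le: "norm (restr S z) \<le> norm z"
  by (rule norm_le_componentwise_cart) simp

lemma norm_restr_UNION:
  assumes "group_partition I"
  shows "norm (restr (\<Union>g\<in>J. I g) z) = L2_set (\<lambda>g. norm (restr (I g) z)) J"
proof -
  have "(norm (restr (\<Union>g\<in>J. I g) z))\<^sup>2 = (\<Sum>g\<in>J. (norm (restr (I g) z))\<^sup>2)"
    unfolding norm_restr_sq
    using assms by (intro sum.UNION_disjoint) (auto simp: group_partition_def disjoint_family_on_def)
  then show ?thesis unfolding L2_set_def by (metis norm_ge_zero real_sqrt_unique)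
qed

lemma inner_eq_sum_groups:
  assumes "group_partition I"
  shows "x \<bullet> y = (\<Sum>g\<in>UNIV. restr (I g) x \<bullet> restr (I g) y)"
proof -
  have "x \<bullet> y = (\<Sum>j\<in>(\<Union>g. I g). x $ j * y $ j)"
    using assms by (simp add: inner_vec_def group_partition_def)
  also have "\<dots> = (\<Sum>g\<in>UNIV. \<Sum>j\<in>I g. x $ j * y $ j)"
    using assms by (intro sum.UNION_disjoint) (auto simp: group_partition_def disjoint_family_on_def)
  finally show ?thesis by (simp add: inner_restr_restr)
qed

lemma group_partition_obtain:
  assumes "group_partition I"
  obtains g where "j \<in> I g"
  using assms UNIV_I[of j] unfolding group_partition_def by (metis UN_E)

text \<open>The least cover exists because the groups partition the indices: the only group that can
  cover an index of the support is the one containing it, so every cover contains all groups that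
  meet the support.\<close>

lemma active_groups_eq:
  assumes "group_partition I"
  shows "active_groups I \<beta> = {g. I g \<inter> supp \<beta> \<noteq> {}}"
  unfolding active_groups_def
proof (rule Least_equality)
  show "supp \<beta> \<subseteq> (\<Union>g\<in>{g. I g \<inter> supp \<beta> \<noteq> {}}. I g)"
    using group_partition_obtain[OF assms] by blast
  fix J assume J: "supp \<beta> \<subseteq> (\<Union>g\<in>J. I g)"
  show "{g. I g \<inter> supp \<beta> \<noteq> {}} \<le> J"
  proof
    fix g assume "g \<in> {g. I g \<inter> supp \<beta> \<noteq> {}}"
    then obtain j where j: "j \<in> I g" "j \<in> supp \<beta>" by auto
    then obtain g' where g': "g' \<in> J" "j \<in> I g'" using J by auto
    have "g = g'" using j g' assms by (auto simp: group_partition_def disjoint_family_on_def)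
    then show "g \<in> J" using g' by simp
  qed
qed

lemma restr_inactive:
  assumes "group_partition I" "g \<notin> active_groups I \<beta>"
  shows "restr (I g) \<beta> = 0"
  using assms by (auto simp: active_groups_eq vec_eq_iff supp_def)

lemma card_active_pos:
  assumes "group_partition I" "\<beta> \<noteq> 0"
  shows "0 < card (active_groups I \<beta>)"
proof -
  obtain j where "\<beta> $ j \<noteq> 0" using assms(2) by (auto simp: vec_eq_iff)
  moreover obtain g where "j \<in> I g" by (rule group_partition_obtain[OF assms(1)])
  ultimately have "g \<in> active_groups I \<beta>" using assms(1) by (auto simp: active_groups_eq supp_def)
  then show ?thesis by (auto simp: card_gt_0_iff)
qed

text \<open>The condition \<open>2 * N * \<alpha> \<le> l * CARD('n)\<close> makes the noise term at
  most \<open>l / \<alpha>\<close> times the norms of \<open>h\<close>, a fraction of the penalty.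
  In the resulting inequality \<open>basic\<close>, discarding the quadratic term gives the cone
  membership; keeping it and applying the restricted eigenvalue bound gives an inequality between
  \<open>\<kappa>\<close> times the square of \<open>norm h\<close> and a multiple of
  \<open>norm h\<close>.\<close>

lemma group_lasso_error_bound:
  fixes X :: "real^'p::finite^'n::finite" and \<beta> b :: "real^'p" and \<epsilon> :: "real^'n"
    and I :: "'g::finite \<Rightarrow> 'p set" and \<alpha> \<kappa> N l :: real
  assumes part: "group_partition I" and s: "s = card (active_groups I \<beta>)" "0 < s"
    and alpha: "\<alpha> \<ge> 2" and kappa: "0 < \<kappa>" and N: "0 < N" "2 * N * \<alpha> \<le> l * CARD('n)"
    and RE: "ereal \<kappa> \<le> group_RE X I s (\<alpha> / (\<alpha> - 1)) (sqrt s / (\<alpha> - 1))"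
    and opt: "is_arg_min (group_lasso_objective X I (X *v \<beta> + \<epsilon>) l) (\<lambda>_. True) b"
    and noise: "\<And>K. card K = s \<Longrightarrow>
       (\<Sum>g\<in>K. (norm (restr (I g) (transpose X *v \<epsilon>)))\<^sup>2) \<le> real s * (4/5 * N)\<^sup>2"
  shows "norm (b - \<beta>) \<le> 3/2 * (l * sqrt s) / \<kappa>"
proof (cases "b = \<beta>")
  \<comment> \<open>The restricted eigenvalue only concerns nonzero vectors, so this case is
    separate; it only needs \<open>l\<close> to be nonnegative.\<close>
  case True
  have "0 \<le> 2 * N * \<alpha>" using N alpha by simp
  then have "0 \<le> l" using N(2) by (meson order_trans of_nat_0_less_iff zero_less_card_finite zero_le_mult_iff not_less)
  then show ?thesis using True kappa by simp
next
  case False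
  define n where "n = real CARD('n)"
  have n: "0 < n" by (simp add: n_def)
  define h where "h = b - \<beta>"
  have h0: "h \<noteq> 0" using False by (simp add: h_def)
  define a where "a g = norm (restr (I g) h)" for g
  define e where "e g = norm (restr (I g) (transpose X *v \<epsilon>))" for g
  have a: "0 \<le> a g" for g by (simp add: a_def)
  define A where "A = active_groups I \<beta>"
  have "s \<le> CARD('g)" unfolding s(1) by (rule card_mono) auto
  then obtain J \<tau> where J: "card J = s" "\<tau> \<in> range a" "\<And>j. j \<in> J \<Longrightarrow> \<tau> \<le> a j" "\<And>g. g \<notin> J \<Longrightarrow> a g \<le> \<tau>"
    using ex_top_set[OF _ s(2), of a] by metis
  have tau: "0 \<le> \<tau>" using J(2) a by auto
  define Q where "Q = (norm (X *v h))\<^sup>2"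
  define D where "D = L2_set a J"
  have D0: "0 \<le> D" by (simp add: D_def L2_set_nonneg)
  have aD: "sum a J \<le> sqrt s * D"
  proof -
    have "sum a J \<le> L2_set a J * L2_set (\<lambda>_. 1) J"
      using L2_set_mult_ineq[of a "\<lambda>_. 1" J] a by simp
    then show ?thesis using J(1) by (simp add: L2_set_def D_def mult.commute)
  qed
  have DL: "D = norm (restr (\<Union>g\<in>J. I g) h)"
    unfolding D_def using norm_restr_UNION[OF part, of J h] by (simp add: a_def[abs_def])
  have l0: "0 \<le> l" "2 * N / n \<le> l / \<alpha>"
  proof -
    show "2 * N / n \<le> l / \<alpha>" using N(2) n alpha by (simp add: field_simps n_def)
    then have "0 < l / \<alpha>" using N n by (smt (verit) divide_pos_pos)
    then show "0 \<le> l" using alpha by (simp add: zero_less_divide_iff)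
  qed
  have ip: "\<epsilon> \<bullet> (X *v h) \<le> N * (sqrt s * D + sum a (- J))"
  proof -
    have "\<epsilon> \<bullet> (X *v h) = (transpose X *v \<epsilon>) \<bullet> h" by (simp add: dot_lmul_matrix)
    also have "\<dots> = (\<Sum>g\<in>UNIV. restr (I g) (transpose X *v \<epsilon>) \<bullet> restr (I g) h)"
      by (rule inner_eq_sum_groups[OF part])
    also have "\<dots> \<le> (\<Sum>g\<in>UNIV. a g * e g)"
      by (intro sum_mono) (metis a_def e_def norm_cauchy_schwarz mult.commute)
    also have "\<dots> \<le> N * (sqrt s * D + sum a (- J))"
      unfolding D_def
      by (rule sum_mult_le_top[OF _ _ J(1) s(2) tau J(3,4) N(1)]) (use noise in \<open>auto simp: a_def e_def\<close>)
    finally show ?thesis .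
  qed
  have pen: "(\<Sum>g\<in>UNIV. norm (restr (I g) \<beta>)) - (\<Sum>g\<in>UNIV. norm (restr (I g) b)) \<le> sum a J - sum a (- J)"
  proof -
    have r: "restr (I g) b = restr (I g) \<beta> + restr (I g) h" for g
      unfolding h_def by (simp add: vec_eq_iff)
    have "(\<Sum>g\<in>UNIV. norm (restr (I g) \<beta>)) - (\<Sum>g\<in>UNIV. norm (restr (I g) b))
        = (\<Sum>g\<in>UNIV. norm (restr (I g) \<beta>) - norm (restr (I g) b))" by (simp add: sum_subtractf)
    \<comment> \<open>Triangle inequality on the active groups; on the others the truth vanishes, so
      \<open>b\<close> and \<open>h\<close> agree there.\<close>
    also have "\<dots> \<le> (\<Sum>g\<in>UNIV. if g \<in> A then a g else - a g)"
    proof (rule sum_mono)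
      fix g
      show "norm (restr (I g) \<beta>) - norm (restr (I g) b) \<le> (if g \<in> A then a g else - a g)"
        using norm_triangle_ineq4[of "restr (I g) b" "restr (I g) h"] restr_inactive[OF part, of g \<beta>]
        by (auto simp: a_def A_def r)
    qed
    also have "\<dots> = sum a A - sum a (- A)"
      by (simp add: sum.If_cases sum_negf Compl_eq[symmetric])
    \<comment> \<open>In this form only the first term depends on the set, so the active groups can
      be exchanged for \<open>J\<close>, which has the same size and the largest sum.\<close>
    also have "\<dots> = 2 * sum a A - sum a UNIV"
      using sum.subset_diff[of A UNIV a] by (simp add: Compl_eq_Diff_UNIV)
    also have "\<dots> \<le> 2 * sum a J - sum a UNIV"
      using sum_le_sum_top[of A J \<tau> a] J s by (simp add: A_def)
    also have "\<dots> = sum a J - sum a (- J)"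
      using sum.subset_diff[of J UNIV a] by (simp add: Compl_eq_Diff_UNIV)
    finally show ?thesis .
  qed
  have basic: "Q / n \<le> l / \<alpha> * (sqrt s * D + sum a (- J)) + l * (sum a J - sum a (- J))"
  proof -
    have "group_lasso_objective X I (X *v \<beta> + \<epsilon>) l b \<le> group_lasso_objective X I (X *v \<beta> + \<epsilon>) l \<beta>"
      using opt by (auto simp: is_arg_min_def not_less)
    moreover have "X *v \<beta> + \<epsilon> - X *v b = \<epsilon> - X *v h"
      by (simp add: h_def matrix_vector_mult_diff_distrib)
    moreover have "(norm (\<epsilon> - X *v h))\<^sup>2 = (norm \<epsilon>)\<^sup>2 - 2 * (\<epsilon> \<bullet> (X *v h)) + Q"
      by (simp add: Q_def power2_norm_eq_inner algebra_simps inner_commute)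
    ultimately have "((norm \<epsilon>)\<^sup>2 - 2 * (\<epsilon> \<bullet> (X *v h)) + Q) / n + l * (\<Sum>g\<in>UNIV. norm (restr (I g) b))
        \<le> (norm \<epsilon>)\<^sup>2 / n + l * (\<Sum>g\<in>UNIV. norm (restr (I g) \<beta>))"
      unfolding group_lasso_objective_def n_def by simp
    then have "Q / n \<le> 2 / n * (\<epsilon> \<bullet> (X *v h))
        + l * ((\<Sum>g\<in>UNIV. norm (restr (I g) \<beta>)) - (\<Sum>g\<in>UNIV. norm (restr (I g) b)))"
      by (simp add: algebra_simps add_divide_distrib diff_divide_distrib)
    also have "\<dots> \<le> 2 / n * (N * (sqrt s * D + sum a (- J))) + l * (sum a J - sum a (- J))"
      using ip pen n l0 by (intro add_mono mult_left_mono) auto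
    also have "2 / n * (N * (sqrt s * D + sum a (- J))) = 2 * N / n * (sqrt s * D + sum a (- J))"
      by simp
    also have "\<dots> \<le> l / \<alpha> * (sqrt s * D + sum a (- J))"
      using l0(2) D0 a by (intro mult_right_mono) (auto intro!: add_nonneg_nonneg sum_nonneg)
    finally show ?thesis by simp
  qed
  have l_pos: "0 < l"
  proof -
    have "0 < 2 * N / n" using N n by simp
    then show ?thesis using l0 alpha by (smt (verit) zero_less_divide_iff)
  qed
  \<comment> \<open>After division by \<open>l / \<alpha>\<close> the sum over \<open>- J\<close>
    has coefficient \<open>1 - \<alpha>\<close>; solving for it produces the two constants of the
    cone.\<close>
  have cone: "h \<in> Omega_cone I J (\<alpha> / (\<alpha> - 1)) (sqrt s / (\<alpha> - 1))"
  proof -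
    have "0 \<le> Q / n" using n by (simp add: Q_def)
    also note basic
    also have "l / \<alpha> * (sqrt s * D + sum a (- J)) + l * (sum a J - sum a (- J))
       = l / \<alpha> * (sqrt s * D + sum a (- J) + \<alpha> * (sum a J - sum a (- J)))"
      using alpha by (simp add: field_simps)
    finally have "0 \<le> sqrt s * D + sum a (- J) + \<alpha> * (sum a J - sum a (- J))"
      using l_pos alpha by (simp add: zero_le_mult_iff divide_nonneg_pos zero_le_divide_iff not_le)
    then have "(\<alpha> - 1) * sum a (- J) \<le> \<alpha> * sum a J + sqrt s * D"
      by (simp add: algebra_simps)
    then have "sum a (- J) \<le> (\<alpha> * sum a J + sqrt s * D) / (\<alpha> - 1)"
      using alpha by (simp add: pos_le_divide_eq mult.commute)
    then show ?thesis
      using alpha unfolding Omega_cone_def DL a_def by (simp add: add_divide_distrib)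
  qed
  have "ereal \<kappa> \<le> ereal (rayleigh X h)"
    using RE unfolding group_RE_def
    by (rule order_trans) (intro INF_lower2[of J] INF_lower; use J cone h0 in simp)
  then have "\<kappa> \<le> (h \<bullet> ((transpose X ** X) *v h)) / (n * (norm h)\<^sup>2)"
    by (simp add: rayleigh_def n_def)
  also have "h \<bullet> ((transpose X ** X) *v h) = Q"
    unfolding Q_def power2_norm_eq_inner matrix_vector_mul_assoc[symmetric]
    by (metis dot_lmul_matrix inner_commute transpose_matrix_vector)
  finally have "\<kappa> * (norm h)\<^sup>2 \<le> Q / n" using h0 n by (simp add: field_simps)
  \<comment> \<open>Outside \<open>J\<close> the total coefficient \<open>l / \<alpha> - l\<close>
    is not positive, so that part is dropped.\<close>
  also have "\<dots> \<le> l / \<alpha> * (sqrt s * D) + l * sum a J"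
  proof -
    have "l / \<alpha> * sum a (- J) \<le> l * sum a (- J)"
      using l_pos alpha a by (intro mult_right_mono sum_nonneg) (auto simp: field_simps)
    then show ?thesis using basic by (simp add: algebra_simps)
  qed
  \<comment> \<open>Here \<open>\<alpha> \<ge> 2\<close> is used; the constant \<open>3/2\<close> is
    \<open>1/2 + 1\<close>.\<close>
  also have "\<dots> \<le> l / 2 * (sqrt s * D) + l * (sqrt s * D)"
    using l_pos alpha aD D0 by (intro add_mono mult_right_mono mult_left_mono divide_left_mono) auto
  also have "\<dots> = 3/2 * (l * sqrt s) * D" by simp
  also have "\<dots> \<le> 3/2 * (l * sqrt s) * norm h"
    unfolding DL using l_pos by (intro mult_left_mono norm_restr_le) auto
  finally have "\<kappa> * norm h \<le> 3/2 * (l * sqrt s)" using h0 by (simp add: power2_eq_square)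
  then show ?thesis using kappa unfolding h_def by (simp add: field_simps)
qed

subsection \<open>The largest eigenvalue of a Gram matrix\<close>

lemma matrix_vector_mult_restr_cols: "restr_cols S X *v v = X *v restr S v"
  unfolding restr_cols_def matrix_vector_mult_def vec_eq_iff by (auto intro!: sum.cong)

text \<open>Eigenvectors of distinct eigenvalues are orthogonal, hence linearly independent.\<close>

lemma finite_gram_eigenvalues: "finite (gram_eigenvalues X S)"
proof -
  define A where "A = transpose (restr_cols S X) ** restr_cols S X"
  have sym: "(A *v x) \<bullet> y = x \<bullet> (A *v y)" for x y
    unfolding A_def matrix_vector_mul_assoc[symmetric]
    by (metis dot_lmul_matrix inner_commute transpose_matrix_vector)
  \<comment> \<open>One eigenvector is chosen per eigenvalue; the choice is injective because a
    nonzero vector determines its eigenvalue.\<close>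
  define f where "f \<mu> = (SOME v. v \<noteq> 0 \<and> A *v v = \<mu> *\<^sub>R v)" for \<mu>
  have f: "f \<mu> \<noteq> 0 \<and> A *v f \<mu> = \<mu> *\<^sub>R f \<mu>" if "\<mu> \<in> gram_eigenvalues X S" for \<mu>
    unfolding f_def by (rule someI_ex) (use that in \<open>auto simp: gram_eigenvalues_def A_def\<close>)
  have inj: "inj_on f (gram_eigenvalues X S)"
    by (rule inj_onI) (metis f scaleR_right_imp_eq)
  have orth: "f \<mu> \<bullet> f \<nu> = 0" if "\<mu> \<in> gram_eigenvalues X S" "\<nu> \<in> gram_eigenvalues X S" "\<mu> \<noteq> \<nu>" for \<mu> \<nu>
    using sym[of "f \<mu>" "f \<nu>"] f[OF that(1)] f[OF that(2)] that(3) by simp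
  have "independent (f ` gram_eigenvalues X S)"
    by (rule pairwise_orthogonal_independent)
      (use f in \<open>auto simp: pairwise_def orthogonal_def intro: orth\<close>)
  then have "finite (f ` gram_eigenvalues X S)" by (rule independent_imp_finite)
  then show ?thesis by (rule finite_imageD[OF _ inj])
qed

text \<open>A maximiser \<open>v\<close> of the Rayleigh quotient on the unit sphere of the vectors supported in
  \<open>S\<close> is an eigenvector: \<open>q\<close> below is a positive semidefinite quadratic form that vanishes at \<open>v\<close>,
  so its polar form \<open>b v\<close> vanishes identically.\<close>

lemma norm_matrix_vector_mult_restr_le:
  assumes "S \<noteq> {}"
  shows "(norm (X *v restr S z))\<^sup>2 \<le> mu_max X S * (norm z)\<^sup>2"
proof -
  define K where "K = {v. norm v = 1 \<and> restr S v = v}"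
  have contr: "continuous_on UNIV (restr S)"
    using linear_restr[of S] by (simp add: linear_continuous_on linear_conv_bounded_linear)
  have "compact (sphere 0 1 \<inter> {v. restr S v = v})"
    by (intro compact_Int_closed compact_sphere closed_Collect_eq contr continuous_on_id)
  moreover have "K = sphere 0 1 \<inter> {v. restr S v = v}" by (auto simp: K_def)
  ultimately have "compact K" by simp
  \<comment> \<open>Nonemptiness of \<open>S\<close> makes the restricted unit sphere nonempty, so
    that a maximiser exists.\<close>
  moreover obtain j where j: "j \<in> S" using assms by auto
  then have "axis j 1 \<in> K" by (simp add: K_def vec_eq_iff norm_axis_1) (simp add: axis_def)
  then have "K \<noteq> {}" by auto
  moreover have "continuous_on K (\<lambda>v. (norm (X *v v))\<^sup>2)" by (intro continuous_intros)
  ultimately obtain v where v: "v \<in> K" "\<And>w. w \<in> K \<Longrightarrow> (norm (X *v w))\<^sup>2 \<le> (norm (X *v v))\<^sup>2"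
    using continuous_attains_sup[of K "\<lambda>v. (norm (X *v v))\<^sup>2"] by auto
  define \<mu> where "\<mu> = (norm (X *v v))\<^sup>2"
  have le: "(norm (X *v restr S w))\<^sup>2 \<le> \<mu> * (norm w)\<^sup>2" for w
  proof (cases "restr S w = 0")
    case True
    then show ?thesis by (simp add: \<mu>_def)
  next
    case False
    define u where "u = restr S w /\<^sub>R norm (restr S w)"
    have "u \<in> K" using False by (auto simp: K_def u_def vec_eq_iff)
    then have "(norm (X *v u))\<^sup>2 \<le> \<mu>" using v by (simp add: \<mu>_def)
    moreover have "X *v u = (X *v restr S w) /\<^sub>R norm (restr S w)"
      by (simp add: u_def matrix_vector_mult_scaleR)
    ultimately have "(norm (X *v restr S w))\<^sup>2 \<le> \<mu> * (norm (restr S w))\<^sup>2"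
      using False by (simp add: power_mult_distrib field_simps)
    also have "\<dots> \<le> \<mu> * (norm w)\<^sup>2"
      by (intro mult_left_mono power_mono norm_restr_le) (auto simp: \<mu>_def)
    finally show ?thesis .
  qed
  define A where "A = transpose (restr_cols S X) ** restr_cols S X"
  have A: "x \<bullet> (A *v y) = (X *v restr S x) \<bullet> (X *v restr S y)" for x y
    unfolding A_def matrix_vector_mul_assoc[symmetric]
    by (metis dot_lmul_matrix inner_commute transpose_matrix_vector matrix_vector_mult_restr_cols)
  define b where "b x y = x \<bullet> (\<mu> *\<^sub>R y - A *v y)" for x y
  define q where "q x = b x x" for x
  have b_sym: "b x y = b y x" for x y by (simp add: b_def inner_diff_right A inner_commute)
  have q: "0 \<le> q x" for x
    using le[of x] by (simp add: q_def b_def inner_diff_right A flip: power2_norm_eq_inner)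
  have qv: "q v = 0"
    using v by (simp add: q_def b_def inner_diff_right A K_def \<mu>_def flip: power2_norm_eq_inner)
  have "b w v = 0" for w
  proof -
    have *: "0 \<le> 2 * t * b w v + t\<^sup>2 * q w" for t
    proof -
      have "q (v + t *\<^sub>R w) = q v + 2 * t * b w v + t\<^sup>2 * q w"
        using A[of v w] A[of w v]
        by (simp add: q_def b_def inner_add_left inner_diff_right inner_add_right matrix_vector_right_distrib
            matrix_vector_mult_scaleR algebra_simps power2_eq_square inner_commute)
      then show ?thesis using q[of "v + t *\<^sub>R w"] qv by simp
    qed
    show ?thesis
    proof (rule ccontr)
      assume nz: "b w v \<noteq> 0"
      \<comment> \<open>A step in the direction that decreases the linear term, short enough for the
        quadratic term not to compensate it. Adding 1 keeps the denominator positive when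
        \<open>q w\<close> is zero.\<close>
      define t where "t = - b w v / (q w + 1)"
      have q1: "0 < q w + 1" using q[of w] by simp
      have "t\<^sup>2 * q w \<le> t\<^sup>2 * (q w + 1)" by (intro mult_left_mono) auto
      also have "\<dots> = - (t * b w v)" using q1 by (simp add: t_def power2_eq_square)
      finally have "0 \<le> t * b w v" using *[of t] by simp
      also have "t * b w v = - ((b w v)\<^sup>2 / (q w + 1))" by (simp add: t_def power2_eq_square)
      finally show False using nz q1 by (simp add: divide_le_0_iff)
    qed
  qed
  then have "A *v v = \<mu> *\<^sub>R v"
    using vector_eq_ldot[of "\<mu> *\<^sub>R v - A *v v" 0] by (simp add: b_def)
  then have "\<mu> \<in> gram_eigenvalues X S"
    using v(1) unfolding gram_eigenvalues_def A_def K_def by (auto intro!: exI[of _ v])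
  \<comment> \<open>Finiteness of the set of eigenvalues is what gives \<open>Max\<close> its
    meaning here.\<close>
  then have "\<mu> \<le> mu_max X S"
    unfolding mu_max_def by (intro Max_ge finite_gram_eigenvalues)
  then have "\<mu> * (norm z)\<^sup>2 \<le> mu_max X S * (norm z)\<^sup>2" by (intro mult_right_mono) auto
  with le[of z] show ?thesis by linarith
qed

subsection \<open>Exponential moments of the noise\<close>

text \<open>Completing the square: tilting the standard normal density by \<open>exp (c * x)\<close>
  gives the normal density with mean \<open>c\<close>, up to the factor
  \<open>exp (c\<^sup>2 / 2)\<close>.\<close>

lemma nn_integral_normal_exp_linear:
  "(\<integral>\<^sup>+x. ennreal (exp (c * x)) \<partial>density lborel (\<lambda>x. ennreal (std_normal_density x))) = ennreal (exp (c\<^sup>2 / 2))"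
proof -
  have "std_normal_density x * exp (c * x) = exp (c\<^sup>2 / 2) * normal_density c 1 x" for x
    by (simp add: normal_density_def power2_eq_square field_simps flip: exp_add)
  then have "(\<integral>\<^sup>+x. ennreal (exp (c * x)) \<partial>density lborel (\<lambda>x. ennreal (std_normal_density x)))
     = (\<integral>\<^sup>+x. ennreal (exp (c\<^sup>2 / 2) * normal_density c 1 x) \<partial>lborel)"
    by (subst nn_integral_density) (auto simp flip: ennreal_mult)
  also have "\<dots> = ennreal (exp (c\<^sup>2 / 2))"
    by (subst nn_integral_eq_integral) (auto intro!: integrable_normal_density)
  finally show ?thesis .
qed

text \<open>The exponent \<open>- 1/2 + 3/8 = - 1/8\<close> is that of a centred normal density with
  standard deviation 2. The weight \<open>3/8\<close> is chosen for this: the mean is exactly 2,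
  which becomes the factor 2 per coordinate in the bounds below.\<close>

lemma nn_integral_normal_exp_square:
  "(\<integral>\<^sup>+x. ennreal (exp (3/8 * x\<^sup>2)) \<partial>density lborel (\<lambda>x. ennreal (std_normal_density x))) = 2"
proof -
  have "sqrt (2 * pi * 2\<^sup>2) = 2 * sqrt (2 * pi)"
    unfolding real_sqrt_mult real_sqrt_power[symmetric] by simp
  moreover have "exp (- x\<^sup>2 / 2) * exp (3/8 * x\<^sup>2) = exp (- x\<^sup>2 / 8)" for x :: real
    by (simp flip: exp_add)
  ultimately have "std_normal_density x * exp (3/8 * x\<^sup>2) = 2 * normal_density 0 2 x" for x
    by (simp add: normal_density_def del: real_sqrt_mult)
  then have "(\<integral>\<^sup>+x. ennreal (exp (3/8 * x\<^sup>2)) \<partial>density lborel (\<lambda>x. ennreal (std_normal_density x)))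
     = (\<integral>\<^sup>+x. ennreal (2 * normal_density 0 2 x) \<partial>lborel)"
    by (subst nn_integral_density) (auto simp flip: ennreal_mult)
  also have "\<dots> = 2"
    by (subst nn_integral_eq_integral) (auto intro!: integrable_normal_density)
  finally show ?thesis .
qed

lemma borel_measurable_vec_lambda [measurable]:
  fixes f :: "'i::finite \<Rightarrow> 'a \<Rightarrow> real"
  assumes "\<And>i. f i \<in> borel_measurable M"
  shows "(\<lambda>x. \<chi> i. f i x) \<in> borel_measurable M"
proof (rule borel_measurable_euclidean_space[THEN iffD2], intro ballI)
  fix b :: "real^'i" assume "b \<in> Basis"
  then obtain i where "b = axis i 1" by (auto simp: Basis_vec_def)
  then show "(\<lambda>x. (\<chi> i. f i x) \<bullet> b) \<in> borel_measurable M"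
    using assms by (simp add: inner_axis)
qed

lemma borel_measurable_matrix_vector_mult [measurable (raw)]:
  fixes A :: "'a \<Rightarrow> real^'p::finite^'n::finite"
  assumes [measurable]: "A \<in> borel_measurable M" "v \<in> borel_measurable M"
  shows "(\<lambda>x. A x *v v x) \<in> borel_measurable M"
  unfolding matrix_vector_mult_def
  by (intro borel_measurable_vec_lambda borel_measurable_sum borel_measurable_times
      borel_measurable_continuous_on[where f="\<lambda>v. v $ _"] borel_measurable_continuous_on[where f="\<lambda>A. A $ _ $ _"])
    (auto intro!: continuous_intros)

lemma borel_measurable_transpose [measurable (raw)]:
  fixes A :: "'a \<Rightarrow> real^'p::finite^'n::finite"
  assumes [measurable]: "A \<in> borel_measurable M"
  shows "(\<lambda>x. transpose (A x)) \<in> borel_measurable M"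
  by (rule borel_measurable_continuous_on[OF _ assms])
    (auto intro!: continuous_intros simp: transpose_def)

lemma borel_measurable_restr [measurable (raw)]:
  fixes v :: "'a \<Rightarrow> real^'p::finite"
  assumes "v \<in> borel_measurable M"
  shows "(\<lambda>x. restr S (v x)) \<in> borel_measurable M"
  by (rule borel_measurable_continuous_on[OF linear_continuous_on assms])
    (simp add: linear_restr linear_conv_bounded_linear[symmetric])

text \<open>By independence the exponential of the inner product factorises over the coordinates,
  and the sub-Gaussian exponents add up to the squared norm of \<open>u\<close>.\<close>

lemma indep_sub_gaussian_mgf:
  fixes Z :: "'w \<Rightarrow> real^'n::finite"
  assumes "prob_space M" and "prob_space.indep_vars M (\<lambda>_. borel) (\<lambda>i \<omega>. Z \<omega> $ i) UNIV"
    and "\<And>i. sub_gaussian M \<sigma> (\<lambda>\<omega>. Z \<omega> $ i)"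
  shows "(\<integral>\<^sup>+\<omega>. ennreal (exp (u \<bullet> Z \<omega>)) \<partial>M) \<le> ennreal (exp (\<sigma>\<^sup>2 * (norm u)\<^sup>2 / 2))"
proof -
  interpret prob_space M by fact
  have "indep_vars (\<lambda>_. borel) (\<lambda>i \<omega>. ennreal (exp (u $ i * (Z \<omega> $ i)))) UNIV"
    by (rule indep_vars_compose2[OF assms(2)]) measurable
  then have "(\<integral>\<^sup>+\<omega>. (\<Prod>i\<in>UNIV. ennreal (exp (u $ i * (Z \<omega> $ i)))) \<partial>M)
      = (\<Prod>i\<in>UNIV. \<integral>\<^sup>+\<omega>. ennreal (exp (u $ i * (Z \<omega> $ i))) \<partial>M)"
    by (rule indep_vars_nn_integral[rotated]) auto
  also have "\<dots> \<le> (\<Prod>i\<in>UNIV. ennreal (exp (\<sigma>\<^sup>2 * (u $ i)\<^sup>2 / 2)))"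
  proof (rule prod_mono_ennreal)
    fix i
    have "integrable M (\<lambda>\<omega>. exp (u $ i * (Z \<omega> $ i)))"
      and *: "(\<integral>\<omega>. exp (u $ i * (Z \<omega> $ i)) \<partial>M) \<le> exp (\<sigma>\<^sup>2 * (u $ i)\<^sup>2 / 2)"
      using assms(3)[of i] by (auto simp: sub_gaussian_def)
    then have "(\<integral>\<^sup>+\<omega>. ennreal (exp (u $ i * (Z \<omega> $ i))) \<partial>M) = ennreal (\<integral>\<omega>. exp (u $ i * (Z \<omega> $ i)) \<partial>M)"
      by (intro nn_integral_eq_integral) auto
    then show "(\<integral>\<^sup>+\<omega>. ennreal (exp (u $ i * (Z \<omega> $ i))) \<partial>M) \<le> ennreal (exp (\<sigma>\<^sup>2 * (u $ i)\<^sup>2 / 2))"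
      using * by (simp add: ennreal_leI)
  qed
  also have "\<dots> = ennreal (exp (\<sigma>\<^sup>2 * (norm u)\<^sup>2 / 2))"
  proof -
    have "(\<Sum>i\<in>UNIV. \<sigma>\<^sup>2 * (u $ i)\<^sup>2 / 2) = \<sigma>\<^sup>2 * (norm u)\<^sup>2 / 2"
      unfolding power2_norm_eq_inner inner_vec_def
      by (simp add: sum_distrib_left sum_divide_distrib power2_eq_square[of "u $ _"])
    then show ?thesis by (simp add: prod_ennreal exp_sum[symmetric])
  qed
  finally show ?thesis
    by (simp add: prod_ennreal exp_sum[symmetric] inner_vec_def)
qed

text \<open>The square is linearised by an auxiliary standard Gaussian vector \<open>\<gamma>\<close>
  on the coordinates in \<open>S\<close>: \<open>exp (r\<^sup>2 \<parallel>v\<parallel>\<^sup>2 / 2)\<close> is the mean of \<open>exp (r \<gamma> \<bullet> v)\<close>.\<close>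

lemma sub_gaussian_exp_norm_sq:
  fixes Z :: "'w \<Rightarrow> real^'n::finite" and A :: "real^'p::finite^'n"
  assumes M: "prob_space M" and Z [measurable]: "Z \<in> borel_measurable M"
    and mgf: "\<And>u. (\<integral>\<^sup>+\<omega>. ennreal (exp (u \<bullet> Z \<omega>)) \<partial>M) \<le> ennreal (exp (\<sigma>\<^sup>2 * (norm u)\<^sup>2 / 2))"
    and A: "\<And>z. (norm (A *v restr S z))\<^sup>2 \<le> c * (norm z)\<^sup>2" and "0 < c" "0 < \<sigma>"
  shows "(\<integral>\<^sup>+\<omega>. ennreal (exp (3 / (8 * \<sigma>\<^sup>2 * c) * (norm (restr S (transpose A *v Z \<omega>)))\<^sup>2)) \<partial>M) \<le> 2 ^ card S"
proof -
  interpret M: prob_space M by fact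
  define N where "N = density lborel (\<lambda>x. ennreal (std_normal_density x))"
  interpret N: prob_space N unfolding N_def by (rule prob_space_normal_density) simp
  have [measurable_cong]: "sets N = sets borel" by (simp add: N_def)
  interpret P: product_prob_space "\<lambda>_. N" S ..
  define P where "P = PiM S (\<lambda>_. N)"
  interpret PP: prob_space P unfolding P_def by (rule P.prob_space_axioms)
  interpret MP: pair_sigma_finite M P ..
  \<comment> \<open>Half the square of \<open>r\<close> is the coefficient in the exponent to be
    linearised.\<close>
  define r where "r = sqrt (3 / (4 * \<sigma>\<^sup>2 * c))"
  have r2: "r\<^sup>2 = 3 / (4 * \<sigma>\<^sup>2 * c)" unfolding r_def using \<open>0 < c\<close> by simp
  define vec where "vec f = (\<chi> j. if j \<in> S then f j else 0)" for f :: "'p \<Rightarrow> real"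
  have restr_vec: "restr S (vec f) = vec f" for f by (simp add: vec_def vec_eq_iff)
  have [measurable]: "vec \<in> borel_measurable P"
    unfolding vec_def
  proof (rule borel_measurable_vec_lambda)
    fix i show "(\<lambda>x. if i \<in> S then x i else 0) \<in> borel_measurable P"
      unfolding P_def by (cases "i \<in> S") simp_all
  qed
  have 1: "ennreal (exp (3 / (8 * \<sigma>\<^sup>2 * c) * (norm (restr S v))\<^sup>2)) = (\<integral>\<^sup>+f. ennreal (exp (r * (vec f \<bullet> v))) \<partial>P)" for v
  proof -
    have "(\<integral>\<^sup>+f. ennreal (exp (r * (vec f \<bullet> v))) \<partial>P) = (\<integral>\<^sup>+f. (\<Prod>j\<in>S. ennreal (exp ((r * (v $ j)) * f j))) \<partial>P)"
    proof (rule nn_integral_cong)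
      fix f
      have "vec f \<bullet> v = (\<Sum>j\<in>S. f j * v $ j)"
        using inner_restr_left[of S "vec f" v] inner_restr[of v S "vec f"]
        by (simp add: restr_vec inner_commute) (simp add: vec_def mult.commute)
      then show "ennreal (exp (r * (vec f \<bullet> v))) = (\<Prod>j\<in>S. ennreal (exp ((r * (v $ j)) * f j)))"
        by (simp add: prod_ennreal exp_sum[symmetric] sum_distrib_left mult_ac)
    qed
    also have "\<dots> = (\<Prod>j\<in>S. \<integral>\<^sup>+x. ennreal (exp ((r * (v $ j)) * x)) \<partial>N)"
      unfolding P_def by (rule P.product_nn_integral_prod) auto
    also have "\<dots> = ennreal (exp (\<Sum>j\<in>S. (r * (v $ j))\<^sup>2 / 2))"
      unfolding N_def nn_integral_normal_exp_linear by (simp add: prod_ennreal exp_sum)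
    also have "(\<Sum>j\<in>S. (r * (v $ j))\<^sup>2 / 2) = 3 / (8 * \<sigma>\<^sup>2 * c) * (norm (restr S v))\<^sup>2"
      by (simp add: norm_restr_sq power_mult_distrib r2 sum_distrib_left mult.assoc)
    finally show ?thesis ..
  qed
  have "(\<integral>\<^sup>+\<omega>. ennreal (exp (3 / (8 * \<sigma>\<^sup>2 * c) * (norm (restr S (transpose A *v Z \<omega>)))\<^sup>2)) \<partial>M)
     = (\<integral>\<^sup>+\<omega>. \<integral>\<^sup>+f. ennreal (exp (r * (vec f \<bullet> (transpose A *v Z \<omega>)))) \<partial>P \<partial>M)"
    unfolding 1 ..
  also have "\<dots> = (\<integral>\<^sup>+f. \<integral>\<^sup>+\<omega>. ennreal (exp (r * (vec f \<bullet> (transpose A *v Z \<omega>)))) \<partial>M \<partial>P)"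
    \<comment> \<open>After the exchange the noise occurs linearly in the inner exponent, so
      \<open>mgf\<close> applies for each fixed Gaussian vector.\<close>
    by (rule MP.Fubini'[symmetric]) (simp add: case_prod_unfold del: transpose_matrix_vector, measurable)
  also have "\<dots> = (\<integral>\<^sup>+f. \<integral>\<^sup>+\<omega>. ennreal (exp ((r *\<^sub>R (A *v vec f)) \<bullet> Z \<omega>)) \<partial>M \<partial>P)"
    by (simp add: inner_commute[of "vec _"] inner_commute[of "A *v _"] dot_lmul_matrix)
  also have "\<dots> \<le> (\<integral>\<^sup>+f. (\<Prod>j\<in>S. ennreal (exp (3/8 * (f j)\<^sup>2))) \<partial>P)"
  proof (rule nn_integral_mono)
    fix f
    note mgf[of "r *\<^sub>R (A *v vec f)"]
    also have "\<sigma>\<^sup>2 * (norm (r *\<^sub>R (A *v vec f)))\<^sup>2 / 2 = 3 / (8 * c) * (norm (A *v restr S (vec f)))\<^sup>2"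
      using \<open>0 < \<sigma>\<close> by (simp add: power_mult_distrib r2 restr_vec)
    \<comment> \<open>Both \<open>\<sigma>\<close> and \<open>c\<close> cancel, leaving
      \<open>3/8\<close> times the squared norm of the Gaussian vector.\<close>
    also have "exp \<dots> \<le> exp (3 / (8 * c) * (c * (norm (vec f))\<^sup>2))"
      unfolding exp_le_cancel_iff using A[of "vec f"] \<open>0 < c\<close> by (intro mult_left_mono) auto
    also have "3 / (8 * c) * (c * (norm (vec f))\<^sup>2) = (\<Sum>j\<in>S. 3/8 * (f j)\<^sup>2)"
      using \<open>0 < c\<close> norm_restr_sq[of S "vec f"] by (simp add: restr_vec sum_distrib_left) (simp add: vec_def)
    finally show "(\<integral>\<^sup>+\<omega>. ennreal (exp ((r *\<^sub>R (A *v vec f)) \<bullet> Z \<omega>)) \<partial>M) \<le> (\<Prod>j\<in>S. ennreal (exp (3/8 * (f j)\<^sup>2)))"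
      by (simp add: prod_ennreal exp_sum[symmetric] ennreal_leI)
  qed
  also have "\<dots> = (\<Prod>j\<in>S. \<integral>\<^sup>+x. ennreal (exp (3/8 * x\<^sup>2)) \<partial>N)"
    unfolding P_def by (rule P.product_nn_integral_prod) auto
  also have "\<dots> = 2 ^ card S"
    unfolding N_def nn_integral_normal_exp_square by simp
  finally show ?thesis .
qed

section \<open>A noise bound holding simultaneously for all sets of groups\<close>

text \<open>The two measures are compared on rectangles, where equality is the product rule for
  independent events. The variables may have different value spaces, as design and noise do.\<close>

lemma (in prob_space) indep_set_distr_pair:
  assumes [measurable]: "X \<in> measurable M N1" "Y \<in> measurable M N2"
    and ind: "indep_set {X -` A \<inter> space M | A. A \<in> sets N1} {Y -` B \<inter> space M | B. B \<in> sets N2}"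
  shows "distr M N1 X \<Otimes>\<^sub>M distr M N2 Y = distr M (N1 \<Otimes>\<^sub>M N2) (\<lambda>\<omega>. (X \<omega>, Y \<omega>))"
proof (rule pair_measure_eqI)
  show "sigma_finite_measure (distr M N1 X)" "sigma_finite_measure (distr M N2 Y)"
    by (auto intro!: prob_space_imp_sigma_finite prob_space_distr)
  show "sets (distr M N1 X \<Otimes>\<^sub>M distr M N2 Y) = sets (distr M (N1 \<Otimes>\<^sub>M N2) (\<lambda>\<omega>. (X \<omega>, Y \<omega>)))"
    by (simp cong: sets_pair_measure_cong)
  fix A B assume "A \<in> sets (distr M N1 X)" "B \<in> sets (distr M N2 Y)"
  then have [measurable]: "A \<in> sets N1" "B \<in> sets N2" by auto
  have "prob ((X -` A \<inter> space M) \<inter> (Y -` B \<inter> space M)) = prob (X -` A \<inter> space M) * prob (Y -` B \<inter> space M)"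
    by (rule indep_setD[OF ind]) (use \<open>A \<in> sets N1\<close> \<open>B \<in> sets N2\<close> in blast)+
  moreover have "(X -` A \<inter> space M) \<inter> (Y -` B \<inter> space M) = (\<lambda>\<omega>. (X \<omega>, Y \<omega>)) -` (A \<times> B) \<inter> space M" by auto
  ultimately show "emeasure (distr M N1 X) A * emeasure (distr M N2 Y) B
      = emeasure (distr M (N1 \<Otimes>\<^sub>M N2) (\<lambda>\<omega>. (X \<omega>, Y \<omega>))) (A \<times> B)"
    by (simp add: emeasure_distr emeasure_eq_measure ennreal_mult)
qed

text \<open>Jensen's inequality through the tangent of \<open>exp\<close> at the mean
  \<open>a\<close>: the linear terms sum to zero.\<close>

lemma exp_mean_le:
  fixes w :: "'i \<Rightarrow> real"
  assumes "finite J" "J \<noteq> {}"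
  shows "exp (sum w J / card J) \<le> (\<Sum>g\<in>J. exp (w g)) / card J"
proof -
  define a where "a = sum w J / card J"
  have c: "0 < real (card J)" using assms by (simp add: card_gt_0_iff)
  have "exp a * (1 + (w g - a)) \<le> exp (w g)" for g
    using exp_ge_add_one_self[of "w g - a"] by (simp add: exp_diff field_simps)
  then have "(\<Sum>g\<in>J. exp a * (1 + (w g - a))) \<le> (\<Sum>g\<in>J. exp (w g))" by (intro sum_mono)
  also have "(\<Sum>g\<in>J. exp a * (1 + (w g - a))) = exp a * card J"
    using c by (simp add: a_def sum.distrib sum_subtractf flip: sum_distrib_left)
  finally show ?thesis using c by (simp add: a_def field_simps)
qed

lemma group_noise_event:
  fixes X :: "'w \<Rightarrow> real^'p::finite^'n::finite" and I :: "'g::finite \<Rightarrow> 'p set" and \<delta> \<sigma> :: real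
  assumes model: "sub_gaussian_linear_model M X y \<beta> \<epsilon> \<sigma>" and \<sigma>: "0 < \<sigma>" and \<delta>: "0 < \<delta>"
    and X: "AE \<omega> in M. \<forall>g z. (norm (X \<omega> *v restr (I g) z))\<^sup>2 \<le> CARD('n) * (norm z)\<^sup>2"
  shows "with_prob_at_least M (1 - \<delta>) (\<lambda>\<omega>. \<forall>K. K \<noteq> {} \<longrightarrow>
     (\<Sum>g\<in>K. (norm (restr (I g) (transpose (X \<omega>) *v \<epsilon> \<omega>)))\<^sup>2)
       \<le> 8/3 * \<sigma>\<^sup>2 * CARD('n) * (card K * ln (CARD('g) / (card K * \<delta>)) + ln 2 * total_size I K))"
proof -
  define n where "n = real CARD('n)"
  have n: "0 < n" by (simp add: n_def)
  define G where "G = real CARD('g)"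
  have G: "0 < G" by (simp add: G_def)
  interpret prob_space M using model by (simp add: sub_gaussian_linear_model_def)
  have [measurable]: "X \<in> borel_measurable M" "\<epsilon> \<in> borel_measurable M"
    using model by (auto simp: sub_gaussian_linear_model_def)
  \<comment> \<open>The shift in the exponent divides by the moment bound
    \<open>2 ^ card (I g)\<close>, so that groups of all sizes are on the same scale.\<close>
  define w where "w g x e = 3 / (8 * \<sigma>\<^sup>2 * n) * (norm (restr (I g) (transpose x *v e)))\<^sup>2 - ln 2 * card (I g)"
    for g and x :: "real^'p^'n" and e
  have [measurable]: "(\<lambda>(x, e). w g x e) \<in> borel_measurable (borel \<Otimes>\<^sub>M borel)" for g
    unfolding w_def case_prod_unfold by (simp del: transpose_matrix_vector, measurable)
  have [measurable]: "(\<lambda>\<omega>. w g (X \<omega>) (\<epsilon> \<omega>)) \<in> borel_measurable M" for g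
    unfolding w_def by (simp del: transpose_matrix_vector, measurable)
  have fixed: "(\<integral>\<^sup>+\<omega>. ennreal (exp (w g x (\<epsilon> \<omega>))) \<partial>M) \<le> 1"
    if "\<And>z. (norm (x *v restr (I g) z))\<^sup>2 \<le> n * (norm z)\<^sup>2" for g x
  proof -
    have "(\<integral>\<^sup>+\<omega>. ennreal (exp (w g x (\<epsilon> \<omega>))) \<partial>M)
      = (\<integral>\<^sup>+\<omega>. ennreal (exp (3 / (8 * \<sigma>\<^sup>2 * n) * (norm (restr (I g) (transpose x *v \<epsilon> \<omega>)))\<^sup>2)) * ennreal ((1/2) ^ card (I g)) \<partial>M)"
    proof (intro nn_integral_cong)
      fix \<omega>
      have "exp (a - ln 2 * real k) = exp a * (1/2) ^ k" for a :: real and k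
      proof -
        have "exp (ln 2 * real k) = (2::real) ^ k" by (metis exp_ln exp_of_nat2_mult zero_less_numeral)
        then show ?thesis by (simp add: exp_diff power_divide)
      qed
      then show "ennreal (exp (w g x (\<epsilon> \<omega>)))
        = ennreal (exp (3 / (8 * \<sigma>\<^sup>2 * n) * (norm (restr (I g) (transpose x *v \<epsilon> \<omega>)))\<^sup>2)) * ennreal ((1/2) ^ card (I g))"
        unfolding w_def by (simp only: ennreal_mult[OF exp_ge_zero zero_le_power] zero_le_divide_1_iff zero_le_numeral)
    qed
    also have "\<dots> = (\<integral>\<^sup>+\<omega>. ennreal (exp (3 / (8 * \<sigma>\<^sup>2 * n) * (norm (restr (I g) (transpose x *v \<epsilon> \<omega>)))\<^sup>2)) \<partial>M) * ennreal ((1/2) ^ card (I g))"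
      by (rule nn_integral_multc) (simp del: transpose_matrix_vector, measurable)
    also have "\<dots> \<le> 2 ^ card (I g) * ennreal ((1/2) ^ card (I g))"
    proof (rule mult_right_mono)
      show "(\<integral>\<^sup>+\<omega>. ennreal (exp (3 / (8 * \<sigma>\<^sup>2 * n) * (norm (restr (I g) (transpose x *v \<epsilon> \<omega>)))\<^sup>2)) \<partial>M) \<le> 2 ^ card (I g)"
        by (rule sub_gaussian_exp_norm_sq[OF prob_space_axioms _ indep_sub_gaussian_mgf])
          (use model that n \<sigma> prob_space_axioms in \<open>auto simp: sub_gaussian_linear_model_def\<close>)
    qed auto
    also have "\<dots> = ennreal (2 ^ card (I g) * (1/2) ^ card (I g))"
      by (simp add: ennreal_mult ennreal_power[symmetric])
    also have "\<dots> = 1" by (simp add: power_divide)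
    finally show ?thesis .
  qed
  have mean: "(\<integral>\<^sup>+\<omega>. ennreal (exp (w g (X \<omega>) (\<epsilon> \<omega>))) \<partial>M) \<le> 1" for g
  proof -
    have pair: "distr M borel X \<Otimes>\<^sub>M distr M borel \<epsilon> = distr M (borel \<Otimes>\<^sub>M borel) (\<lambda>\<omega>. (X \<omega>, \<epsilon> \<omega>))"
      by (rule indep_set_distr_pair) (use model in \<open>auto simp: sub_gaussian_linear_model_def\<close>)
    interpret E: prob_space "distr M borel \<epsilon>" by (rule prob_space_distr) simp
    interpret D: prob_space "distr M borel X" by (rule prob_space_distr) simp
    \<comment> \<open>The set of designs to which \<open>fixed\<close> applies. It is closed, hence
      Borel, so the almost sure statement about \<open>X\<close> transfers to its
      distribution.\<close>
    define Good where "Good = {x :: real^'p^'n. \<forall>z. (norm (x *v restr (I g) z))\<^sup>2 \<le> n * (norm z)\<^sup>2}"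
    have "closed Good"
    proof -
      have "continuous_on UNIV (\<lambda>x :: real^'p^'n. x *v restr (I g) z)" for z
        unfolding matrix_vector_mult_def by (intro continuous_intros continuous_on_vec_lambda)
      then have "closed {x :: real^'p^'n. (norm (x *v restr (I g) z))\<^sup>2 \<le> n * (norm z)\<^sup>2}" for z
        by (intro closed_Collect_le continuous_intros)
      then show ?thesis unfolding Good_def by (rule closed_Collect_all)
    qed
    then have [measurable]: "Good \<in> sets borel" by (rule borel_closed)
    have "(\<integral>\<^sup>+\<omega>. ennreal (exp (w g (X \<omega>) (\<epsilon> \<omega>))) \<partial>M)
       = (\<integral>\<^sup>+p. ennreal (exp (case p of (x, e) \<Rightarrow> w g x e)) \<partial>(distr M borel X \<Otimes>\<^sub>M distr M borel \<epsilon>))"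
      unfolding pair by (subst nn_integral_distr) auto
    also have "\<dots> = (\<integral>\<^sup>+x. \<integral>\<^sup>+e. ennreal (exp (w g x e)) \<partial>distr M borel \<epsilon> \<partial>distr M borel X)"
      by (subst E.nn_integral_fst[symmetric]) auto
    also have "\<dots> = (\<integral>\<^sup>+x. \<integral>\<^sup>+\<omega>. ennreal (exp (w g x (\<epsilon> \<omega>))) \<partial>M \<partial>distr M borel X)"
    proof (rule nn_integral_cong)
      fix x
      have "(\<lambda>e. ennreal (exp (w g x e))) \<in> borel_measurable borel"
        unfolding w_def by (simp del: transpose_matrix_vector, measurable)
      then show "(\<integral>\<^sup>+e. ennreal (exp (w g x e)) \<partial>distr M borel \<epsilon>) = (\<integral>\<^sup>+\<omega>. ennreal (exp (w g x (\<epsilon> \<omega>))) \<partial>M)"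
        by (subst nn_integral_distr) auto
    qed
    also have "\<dots> \<le> (\<integral>\<^sup>+x. 1 \<partial>distr M borel X)"
    proof (rule nn_integral_mono_AE)
      have "AE \<omega> in M. X \<omega> \<in> Good"
        using X by eventually_elim (simp add: Good_def n_def)
      then have "AE x in distr M borel X. x \<in> Good" by (subst AE_distr_iff) auto
      then show "AE x in distr M borel X. (\<integral>\<^sup>+\<omega>. ennreal (exp (w g x (\<epsilon> \<omega>))) \<partial>M) \<le> 1"
        by eventually_elim (auto simp: Good_def intro: fixed)
    qed
    finally show ?thesis using D.emeasure_space_1 by simp
  qed
  define F where "F \<omega> = (\<Sum>g\<in>UNIV. exp (w g (X \<omega>) (\<epsilon> \<omega>)))" for \<omega>
  have [measurable]: "F \<in> borel_measurable M" unfolding F_def by measurable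
  have F: "(\<integral>\<^sup>+\<omega>. ennreal (F \<omega>) \<partial>M) \<le> ennreal G"
  proof -
    have "(\<integral>\<^sup>+\<omega>. ennreal (F \<omega>) \<partial>M) = (\<Sum>g\<in>UNIV. \<integral>\<^sup>+\<omega>. ennreal (exp (w g (X \<omega>) (\<epsilon> \<omega>))) \<partial>M)"
      unfolding F_def by (simp flip: sum_ennreal nn_integral_sum)
    also have "\<dots> \<le> (\<Sum>g\<in>(UNIV::'g set). 1)" by (intro sum_mono mean)
    finally show ?thesis by (simp add: G_def ennreal_of_nat_eq_real_of_nat)
  qed
  \<comment> \<open>The mean of \<open>F\<close> is at most \<open>G\<close>, so Markov's inequality
    bounds the probability of the complement by \<open>\<delta>\<close>. The event involves no set
    \<open>K\<close>.\<close>
  define E where "E = {\<omega> \<in> space M. F \<omega> < G / \<delta>}"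
  have [measurable]: "E \<in> sets M" unfolding E_def by measurable
  have "emeasure M (space M - E) \<le> ennreal \<delta>"
  proof -
    have "space M - E = {\<omega> \<in> space M. 1 \<le> ennreal (\<delta> / G) * ennreal (F \<omega>)}"
      using G \<delta> by (auto simp: E_def field_simps ennreal_mult'[symmetric] F_def sum_nonneg)
    also have "emeasure M \<dots> \<le> ennreal (\<delta> / G) * (\<integral>\<^sup>+\<omega>. ennreal (F \<omega>) * indicator (space M) \<omega> \<partial>M)"
      by (rule nn_integral_Markov_inequality) auto
    also have "(\<integral>\<^sup>+\<omega>. ennreal (F \<omega>) * indicator (space M) \<omega> \<partial>M) = (\<integral>\<^sup>+\<omega>. ennreal (F \<omega>) \<partial>M)"
      by (intro nn_integral_cong) auto
    also have "ennreal (\<delta> / G) * (\<integral>\<^sup>+\<omega>. ennreal (F \<omega>) \<partial>M) \<le> ennreal (\<delta> / G) * ennreal G"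
      using F by (rule mult_left_mono) simp
    also have "\<dots> = ennreal \<delta>" using G \<delta> by (simp flip: ennreal_mult)
    finally show ?thesis .
  qed
  then have "prob (space M - E) \<le> \<delta>" using \<delta> by (simp add: emeasure_eq_measure)
  then have probE: "1 - \<delta> \<le> prob E" using prob_compl[of E] by simp
  show ?thesis unfolding with_prob_at_least_def
  proof (intro bexI[of _ E] conjI ballI allI impI probE)
    fix \<omega> K assume \<omega>: "\<omega> \<in> E" and K: "K \<noteq> ({} :: 'g set)"
    have cK: "0 < real (card K)" using K by (simp add: card_gt_0_iff)
    define T where "T = (\<Sum>g\<in>K. (norm (restr (I g) (transpose (X \<omega>) *v \<epsilon> \<omega>)))\<^sup>2)"
    have "exp ((\<Sum>g\<in>K. w g (X \<omega>) (\<epsilon> \<omega>)) / card K) \<le> (\<Sum>g\<in>K. exp (w g (X \<omega>) (\<epsilon> \<omega>))) / card K"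
      by (rule exp_mean_le) (use K in auto)
    \<comment> \<open>All summands of \<open>F\<close> are positive, so the sum over any
      \<open>K\<close> is dominated by \<open>F\<close>; the averaging keeps \<open>card K\<close>
      in the denominator inside the logarithm.\<close>
    also have "\<dots> \<le> F \<omega> / card K"
      unfolding F_def by (intro divide_right_mono sum_mono2) auto
    also have "\<dots> \<le> G / \<delta> / card K" using \<omega> by (intro divide_right_mono) (auto simp: E_def)
    finally have "exp ((\<Sum>g\<in>K. w g (X \<omega>) (\<epsilon> \<omega>)) / card K) \<le> G / (card K * \<delta>)"
      by (simp add: mult.commute)
    then have "(\<Sum>g\<in>K. w g (X \<omega>) (\<epsilon> \<omega>)) / card K \<le> ln (G / (card K * \<delta>))"
      using G \<delta> cK by (subst ln_ge_iff) auto
    then have "(\<Sum>g\<in>K. w g (X \<omega>) (\<epsilon> \<omega>)) \<le> card K * ln (G / (card K * \<delta>))"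
      using cK by (simp add: field_simps)
    moreover have "(\<Sum>g\<in>K. w g (X \<omega>) (\<epsilon> \<omega>)) = 3 / (8 * \<sigma>\<^sup>2 * n) * T - ln 2 * total_size I K"
      by (simp add: w_def T_def sum_subtractf sum_distrib_left total_size_def del: transpose_matrix_vector)
    ultimately have "3 / (8 * \<sigma>\<^sup>2 * n) * T \<le> card K * ln (G / (card K * \<delta>)) + ln 2 * total_size I K"
      by simp
    then have "T \<le> 8/3 * \<sigma>\<^sup>2 * n * (card K * ln (G / (card K * \<delta>)) + ln 2 * total_size I K)"
      using n \<sigma> by (simp add: pos_divide_le_eq mult_ac)
    then show "(\<Sum>g\<in>K. (norm (restr (I g) (transpose (X \<omega>) *v \<epsilon> \<omega>)))\<^sup>2)
       \<le> 8/3 * \<sigma>\<^sup>2 * CARD('n) * (card K * ln (CARD('g) / (card K * \<delta>)) + ln 2 * total_size I K)"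
      unfolding T_def n_def G_def .
  qed simp
qed

section \<open>From the noise event to the error of the minimiser\<close>

text \<open>The exceptional set of \<open>Q\<close> is covered by a null set; removing it from the
  event for \<open>P\<close> leaves the probability unchanged.\<close>

lemma with_prob_at_least_AE:
  assumes "prob_space M" "with_prob_at_least M q P" "AE \<omega> in M. Q \<omega>"
    and "\<And>\<omega>. \<omega> \<in> space M \<Longrightarrow> P \<omega> \<Longrightarrow> Q \<omega> \<Longrightarrow> R \<omega>"
  shows "with_prob_at_least M q R"
proof -
  interpret prob_space M by fact
  obtain E where E: "E \<in> sets M" "q \<le> measure M E" "\<forall>\<omega>\<in>E. P \<omega>"
    using assms(2) by (auto simp: with_prob_at_least_def)
  obtain N where N: "N \<in> null_sets M" "{\<omega> \<in> space M. \<not> Q \<omega>} \<subseteq> N"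
    using assms(3) by (auto elim!: AE_E simp: null_sets_def)
  have "measure M (E - N) = measure M E"
    using emeasure_Diff_null_set[OF N(1) E(1)] by (simp add: measure_def)
  moreover have "R \<omega>" if "\<omega> \<in> E - N" for \<omega>
    using that E N sets.sets_into_space[OF E(1)] by (intro assms(4)) auto
  ultimately show ?thesis
    using E N unfolding with_prob_at_least_def by (intro bexI[of _ "E - N"]) auto
qed

text \<open>The last condition on \<open>N\<close> says that the noise level dominates the
  probabilistic bound in its worst case, where the \<open>s\<close> groups are the largest ones. The
  choice of \<open>N\<close> is left to the two applications.\<close>

lemma group_lasso_rate:
  fixes X :: "'w \<Rightarrow> real^'p::finite^'n::finite" and I :: "'g::finite \<Rightarrow> 'p set"
    and N l \<alpha> \<kappa> \<delta> \<sigma> :: real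
  assumes model: "sub_gaussian_linear_model M X y \<beta> \<epsilon> \<sigma>" and \<sigma>: "0 < \<sigma>" and \<delta>: "0 < \<delta>"
    and beta: "\<beta> \<noteq> 0" and part: "group_partition I" and alpha: "2 \<le> \<alpha>" and kappa: "0 < \<kappa>"
    and s: "s = card (active_groups I \<beta>)"
    and X: "AE \<omega> in M. \<forall>g z. (norm (X \<omega> *v restr (I g) z))\<^sup>2 \<le> CARD('n) * (norm z)\<^sup>2"
    and RE: "AE \<omega> in M. ereal \<kappa> \<le> group_RE (X \<omega>) I s (\<alpha> / (\<alpha> - 1)) (sqrt s / (\<alpha> - 1))"
    and opt: "AE \<omega> in M. is_arg_min (group_lasso_objective (X \<omega>) I (y \<omega>) l) (\<lambda>_. True) (\<beta>hat \<omega>)"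
    and N: "0 < N" "2 * N * \<alpha> \<le> l * CARD('n)"
      "8/3 * \<sigma>\<^sup>2 * CARD('n) * (s * ln (CARD('g) / (s * \<delta>)) + ln 2 * largest_total_size I s) \<le> s * (4/5 * N)\<^sup>2"
  shows "with_prob_at_least M (1 - \<delta>) (\<lambda>\<omega>. norm (\<beta>hat \<omega> - \<beta>) \<le> 3/2 * (l * sqrt s) / \<kappa>)"
proof (rule with_prob_at_least_AE[OF _ group_noise_event[OF model \<sigma> \<delta> X] AE_conjI[OF RE opt]])
  show "prob_space M" using model by (simp add: sub_gaussian_linear_model_def)
  have s0: "0 < s" using card_active_pos[OF part beta] s by simp
  fix \<omega>
  assume \<omega>: "\<omega> \<in> space M"
  assume noise: "\<forall>K. K \<noteq> {} \<longrightarrow>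
     (\<Sum>g\<in>K. (norm (restr (I g) (transpose (X \<omega>) *v \<epsilon> \<omega>)))\<^sup>2)
       \<le> 8/3 * \<sigma>\<^sup>2 * CARD('n) * (card K * ln (CARD('g) / (card K * \<delta>)) + ln 2 * total_size I K)"
  assume *: "ereal \<kappa> \<le> group_RE (X \<omega>) I s (\<alpha> / (\<alpha> - 1)) (sqrt s / (\<alpha> - 1)) \<and>
      is_arg_min (group_lasso_objective (X \<omega>) I (y \<omega>) l) (\<lambda>_. True) (\<beta>hat \<omega>)"
  have y: "y \<omega> = X \<omega> *v \<beta> + \<epsilon> \<omega>" using model \<omega> by (simp add: sub_gaussian_linear_model_def)
  show "norm (\<beta>hat \<omega> - \<beta>) \<le> 3/2 * (l * sqrt s) / \<kappa>"
  proof (rule group_lasso_error_bound[OF part s s0 alpha kappa N(1,2)])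
    show "ereal \<kappa> \<le> group_RE (X \<omega>) I s (\<alpha> / (\<alpha> - 1)) (sqrt s / (\<alpha> - 1))" using * by simp
    show "is_arg_min (group_lasso_objective (X \<omega>) I (X \<omega> *v \<beta> + \<epsilon> \<omega>) l) (\<lambda>_. True) (\<beta>hat \<omega>)"
      using * y by simp
    fix K :: "'g set" assume K: "card K = s"
    then have "K \<noteq> {}" using s0 by auto
    then have "(\<Sum>g\<in>K. (norm (restr (I g) (transpose (X \<omega>) *v \<epsilon> \<omega>)))\<^sup>2)
       \<le> 8/3 * \<sigma>\<^sup>2 * CARD('n) * (s * ln (CARD('g) / (s * \<delta>)) + ln 2 * total_size I K)"
      using noise K by blast
    also have "\<dots> \<le> 8/3 * \<sigma>\<^sup>2 * CARD('n) * (s * ln (CARD('g) / (s * \<delta>)) + ln 2 * largest_total_size I s)"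
    proof (intro mult_left_mono add_left_mono)
      show "real (total_size I K) \<le> real (largest_total_size I s)"
        using K unfolding largest_total_size_def by (intro of_nat_mono Max_ge) auto
    qed auto
    also note N(3)
    finally show "(\<Sum>g\<in>K. (norm (restr (I g) (transpose (X \<omega>) *v \<epsilon> \<omega>)))\<^sup>2) \<le> real s * (4/5 * N)\<^sup>2" .
  qed
qed

section \<open>The Lasso as the group Lasso of singleton groups\<close>

lemma group_partition_singletons: "group_partition (\<lambda>j. {j})"
  by (auto simp: group_partition_def disjoint_family_on_def)

lemma active_groups_singletons: "active_groups (\<lambda>j. {j}) \<beta> = supp \<beta>"
  by (simp add: active_groups_eq[OF group_partition_singletons])

lemma norm_restr_singleton: "norm (restr {j} z) = \<bar>z $ j\<bar>"
  using norm_restr_sq[of "{j}" z] by (simp add: power2_eq_iff_nonneg[of _ "\<bar>z $ j\<bar>", simplified])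

lemma l1_norm_restr: "l1_norm (restr S z) = (\<Sum>j\<in>S. \<bar>z $ j\<bar>)"
  unfolding l1_norm_def by (rule sum.mono_neutral_cong_right) auto

lemma lasso_RE_eq_group_RE: "lasso_RE X k a b = group_RE X (\<lambda>j. {j}) k a b"
  by (simp add: lasso_RE_def group_RE_def Lambda_cone_def Omega_cone_def l1_norm_restr norm_restr_singleton)

lemma lasso_objective_eq_group: "lasso_objective X y l = group_lasso_objective X (\<lambda>j. {j}) y l"
  by (simp add: fun_eq_iff lasso_objective_def group_lasso_objective_def l1_norm_def norm_restr_singleton)

text \<open>The bound on \<open>k\<close> provides a set of \<open>k\<close> indices, so the maximum
  is taken over a nonempty set.\<close>

lemma largest_total_size_singletons:
  assumes "k \<le> CARD('p::finite)"
  shows "largest_total_size (\<lambda>j::'p. {j}) k = k"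
proof -
  obtain J :: "'p set" where "card J = k" using ex_card[OF assms] by blast
  then have "total_size (\<lambda>j::'p. {j}) ` {J. card J = k} = {k}" by (auto simp: total_size_def)
  then show ?thesis by (simp add: largest_total_size_def)
qed

text \<open>Restriction to one coordinate leaves a multiple of one column, so the column
  normalisation plays the part of the eigenvalue condition on groups.\<close>

lemma norm_matrix_vector_mult_restr_singleton:
  fixes X :: "real^'p::finite^'n::finite"
  assumes "norm (column j X) \<le> sqrt n" "0 \<le> n"
  shows "(norm (X *v restr {j} z))\<^sup>2 \<le> n * (norm z)\<^sup>2"
proof -
  have "X *v restr {j} z = z $ j *\<^sub>R column j X"
  proof (subst vec_eq_iff, intro allI)
    fix i
    have "(\<Sum>k\<in>UNIV. X $ i $ k * restr {j} z $ k) = (\<Sum>k\<in>{j}. X $ i $ k * z $ k)"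
      by (rule sum.mono_neutral_cong_right) auto
    then show "(X *v restr {j} z) $ i = (z $ j *\<^sub>R column j X) $ i"
      by (simp add: matrix_vector_mult_def column_def)
  qed
  then have "(norm (X *v restr {j} z))\<^sup>2 = (z $ j)\<^sup>2 * (norm (column j X))\<^sup>2"
    by (simp add: power_mult_distrib)
  also have "\<dots> \<le> (norm z)\<^sup>2 * n"
  proof (rule mult_mono)
    show "(z $ j)\<^sup>2 \<le> (norm z)\<^sup>2" using power_mono[OF component_le_norm_cart, of z j 2] by simp
    show "(norm (column j X))\<^sup>2 \<le> n" using power_mono[OF assms(1) norm_ge_zero, of 2] assms(2) by simp
  qed (use assms in auto)
  finally show ?thesis by (simp add: mult.commute)
qed

lemma norm_matrix_vector_mult_restr_SUP_le:
  assumes "group_partition I" "(SUP g. mu_max X (I g)) \<le> n"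
  shows "(norm (X *v restr (I g) z))\<^sup>2 \<le> n * (norm z)\<^sup>2"
proof -
  have "(norm (X *v restr (I g) z))\<^sup>2 \<le> mu_max X (I g) * (norm z)\<^sup>2"
    using assms by (intro norm_matrix_vector_mult_restr_le) (simp add: group_partition_def)
  also have "mu_max X (I g) \<le> n"
    by (rule order_trans[OF cSUP_upper assms(2)]) auto
  finally show ?thesis by (simp add: mult_right_mono)
qed

subsection \<open>Rates\<close>

text \<open>The factor \<open>exp 1\<close> keeps the logarithm at least 1 even for
  \<open>k = p\<close>, where \<open>ln (p / k)\<close> vanishes.\<close>

lemma ln_sparsity_ratio:
  fixes k p :: real
  assumes "0 < k" "k \<le> p"
  shows "ln (2 * p * exp 1 / k) = ln (p / k) + ln 2 + 1" "0 \<le> ln (p / k)"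
proof -
  show "ln (2 * p * exp 1 / k) = ln (p / k) + ln 2 + 1"
    using assms ln_mult_pos[of "p / k * 2" "exp 1"] ln_mult_pos[of "p / k" 2]
    by (simp add: mult.commute[of p])
  show "0 \<le> ln (p / k)" using assms by simp
qed

text \<open>Under \<open>2 * k \<le> p\<close> the ratio logarithm is at least \<open>ln 2\<close>,
  hence at least \<open>2/3\<close>, and absorbs the extra terms \<open>ln 2\<close> and 1. Near
  \<open>k = p\<close> no such bound can hold.\<close>

lemma ln_sparsity_ratio_le:
  fixes k p :: real
  assumes "0 < k" "2 * k \<le> p"
  shows "ln (2 * p * exp 1 / k) \<le> 4 * ln (p / k)"
proof -
  have "ln 2 \<le> ln (p / k)" using assms by (simp add: field_simps)
  then show ?thesis using ln_sparsity_ratio(1)[of k p] assms ln2_ge_two_thirds by linarith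
qed

text \<open>The scale-free form of the condition on the noise level, with
  \<open>L = ln (p / k)\<close> and \<open>b = ln (1 / \<delta>)\<close>. The number
  \<open>144\<close> is the square of half the coefficient \<open>24\<close> of the penalty, and
  \<open>16/25\<close> is the square of \<open>4/5\<close>.\<close>

lemma lasso_noise_level:
  fixes A b :: real
  assumes "1 \<le> A" "2/3 \<le> b" "L + ln 2 + 1 = A"
  shows "8/3 * (L + b + ln 2) \<le> 16/25 * (144 * (A * b))"
proof -
  have "2/3 * A \<le> A * b" "b \<le> A * b" "2/3 \<le> A * b"
    using assms(1,2) mult_mono[of 1 A "2/3" b] mult_right_mono[of 1 A b] mult_left_mono[of "2/3" b A] by simp_all
  then show ?thesis using assms(3) by simp
qed

text \<open>The two terms of the penalty absorb separate parts of the noise: the first the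
  logarithms, the second the group sizes, where \<open>r\<close> stands for
  \<open>\<gamma> * m / s\<close>. The 4 is the square of half the coefficient 4 of the second
  term.\<close>

lemma group_lasso_noise_level:
  fixes A b :: real
  assumes "1 \<le> A" "2/3 \<le> b" "L + ln 2 + 1 = A" "0 \<le> r"
  shows "8/3 * (L + b + ln 2 * r) \<le> 16/25 * (144 * (A * (ln 2 + b)) + 4 * r)"
proof -
  have "0 \<le> A * ln 2" using assms(1) by simp
  then have "8/3 * (L + b + ln 2) \<le> 16/25 * (144 * (A * (ln 2 + b)))"
    using lasso_noise_level[OF assms(1-3)] by (simp add: distrib_left)
  moreover have "8/3 * (ln 2 * r) \<le> 16/25 * (4 * r)"
    using mult_right_mono[OF ln2_le_25_over_36 assms(4)] assms(4) by linarith
  moreover have "0 < ln (2::real)" by simp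
  ultimately show ?thesis by (simp only: distrib_left)
qed

lemma lasso_rate:
  fixes X :: "'w \<Rightarrow> real^'p::finite^'n::finite" and \<sigma> \<delta> \<alpha> \<kappa> n p k :: real
  assumes model: "sub_gaussian_linear_model M X y \<beta> \<epsilon> \<sigma>"
    and sigma: "\<sigma> > 0" and beta: "\<beta> \<noteq> 0" and delta: "0 < \<delta>" "\<delta> < 1/2" and alpha: "\<alpha> \<ge> 2"
    and n: "n = real CARD('n)" and p: "p = real CARD('p)" and k: "k = real (card (supp \<beta>))"
    and X: "AE \<omega> in M. \<forall>j. norm (column j (X \<omega>)) \<le> sqrt n" and kappa: "0 < \<kappa>"
    and RE: "AE \<omega> in M. ereal \<kappa> \<le>
          lasso_RE (X \<omega>) (card (supp \<beta>)) (\<alpha> / (\<alpha> - 1)) (sqrt k / (\<alpha> - 1))"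
    and opt: "AE \<omega> in M. is_arg_min
          (lasso_objective (X \<omega>) (y \<omega>)
             (24 * \<alpha> * \<sigma> * sqrt (1/n * ln (2 * p * exp 1 / k) * ln (1/\<delta>))))
          (\<lambda>_. True) (\<beta>hat \<omega>)"
  shows "with_prob_at_least M (1 - \<delta>) (\<lambda>\<omega>.
     norm (\<beta>hat \<omega> - \<beta>) \<le> 36 * (\<alpha> * \<sigma> / \<kappa> * sqrt (k * ln (2 * p * exp 1 / k) * ln (1/\<delta>) / n)))"
proof -
  define I where "I = (\<lambda>j::'p. {j})"
  note part = group_partition_singletons[where 'a='p, folded I_def]
  have act: "active_groups I \<beta> = supp \<beta>" unfolding I_def by (rule active_groups_singletons)
  have k0: "0 < k" using card_active_pos[OF part beta] unfolding act k by simp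
  have kle: "card (supp \<beta>) \<le> CARD('p)" by (rule card_mono) auto
  have kp: "k \<le> p" unfolding k p using kle by simp
  have n0: "0 < n" unfolding n by simp
  define A where "A = ln (2 * p * exp 1 / k)"
  define b where "b = ln (1 / \<delta>)"
  note L = ln_sparsity_ratio[OF k0 kp, folded A_def]
  have A: "1 \<le> A" using L by simp
  have "ln 2 \<le> b" unfolding b_def using delta by (simp add: field_simps)
  then have b: "2/3 \<le> b" using ln2_ge_two_thirds by linarith
  define l where "l = 24 * \<alpha> * \<sigma> * sqrt (1/n * A * b)"
  \<comment> \<open>The largest noise level that the penalty allows: \<open>2 * N * \<alpha>\<close>
    equals \<open>l * n\<close>.\<close>
  define N where "N = 12 * \<sigma> * n * sqrt (1/n * A * b)"
  have U: "0 < 1/n * A * b" using n0 A b by simp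
  have "with_prob_at_least M (1 - \<delta>) (\<lambda>\<omega>. norm (\<beta>hat \<omega> - \<beta>) \<le> 3/2 * (l * sqrt (card (supp \<beta>))) / \<kappa>)"
  proof (rule group_lasso_rate[where I=I and N=N, OF model sigma delta(1) beta part alpha kappa])
    show "card (supp \<beta>) = card (active_groups I \<beta>)" by (simp add: act)
    show "AE \<omega> in M. \<forall>g z. (norm (X \<omega> *v restr (I g) z))\<^sup>2 \<le> CARD('n) * (norm z)\<^sup>2"
      using X
    proof eventually_elim
      case (elim \<omega>)
      then show ?case
        using norm_matrix_vector_mult_restr_singleton[of _ "X \<omega>" n] n0 by (simp add: I_def n)
    qed
    show "AE \<omega> in M. ereal \<kappa> \<le> group_RE (X \<omega>) I (card (supp \<beta>)) (\<alpha> / (\<alpha> - 1)) (sqrt (real (card (supp \<beta>))) / (\<alpha> - 1))"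
      using RE unfolding I_def lasso_RE_eq_group_RE k .
    show "AE \<omega> in M. is_arg_min (group_lasso_objective (X \<omega>) I (y \<omega>) l) (\<lambda>_. True) (\<beta>hat \<omega>)"
      using opt unfolding I_def lasso_objective_eq_group l_def A_def b_def .
    show "0 < N" using sigma n0 U by (simp add: N_def)
    show "2 * N * \<alpha> \<le> l * CARD('n)" by (simp add: N_def l_def n)
    have "8/3 * (ln (p / k) + b + ln 2) \<le> 16/25 * (144 * (A * b))"
      by (rule lasso_noise_level[OF A b]) (use L in simp)
    then have "\<sigma>\<^sup>2 * n * k * (8/3 * (ln (p / k) + b + ln 2)) \<le> \<sigma>\<^sup>2 * n * k * (16/25 * (144 * (A * b)))"
      using n0 k0 by (intro mult_left_mono) auto
    also have "\<sigma>\<^sup>2 * n * k * (16/25 * (144 * (A * b))) = k * (4/5 * N)\<^sup>2"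
      using U n0 by (simp add: N_def power_mult_distrib power2_eq_square[of n] power_divide)
    also have "ln (p / k) + b = ln (p / (k * \<delta>))"
      using k0 kp delta by (simp add: b_def ln_div ln_mult_pos)
    finally show "8/3 * \<sigma>\<^sup>2 * CARD('n) * (card (supp \<beta>) * ln (CARD('p) / (card (supp \<beta>) * \<delta>))
        + ln 2 * largest_total_size I (card (supp \<beta>))) \<le> card (supp \<beta>) * (4/5 * N)\<^sup>2"
      unfolding I_def largest_total_size_singletons[OF kle]
      by (simp add: n[symmetric] p[symmetric] k[symmetric] algebra_simps)
  qed
  \<comment> \<open>The constant is \<open>3/2 * 24 = 36\<close>.\<close>
  moreover have "3/2 * (l * sqrt (card (supp \<beta>))) / \<kappa> = 36 * (\<alpha> * \<sigma> / \<kappa> * sqrt (k * A * b / n))"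
  proof -
    have "sqrt (1/n * A * b) * sqrt k = sqrt (k * A * b / n)"
      by (simp flip: real_sqrt_mult)
    then show ?thesis unfolding l_def k[symmetric] by (simp add: mult.assoc)
  qed
  ultimately show ?thesis unfolding A_def b_def by simp
qed

lemma group_rate:
  fixes X :: "'w \<Rightarrow> real^'p::finite^'n::finite" and I :: "'g::finite \<Rightarrow> 'p set"
    and \<sigma> \<delta> \<alpha> \<kappa> \<gamma> n G s m :: real
  assumes model: "sub_gaussian_linear_model M X y \<beta> \<epsilon> \<sigma>"
    and sigma: "\<sigma> > 0" and beta: "\<beta> \<noteq> 0" and groups: "group_partition I"
    and delta: "0 < \<delta>" "\<delta> < 1/2" and alpha: "\<alpha> \<ge> 2"
    and n: "n = real CARD('n)" and G: "G = real CARD('g)" and s: "s = real (card (active_groups I \<beta>))"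
    and m: "0 \<le> m" and X: "AE \<omega> in M. (SUP g. mu_max (X \<omega>) (I g)) \<le> n" and gamma: "1 \<le> \<gamma>"
    and m0: "real (largest_total_size I (card (active_groups I \<beta>))) \<le> \<gamma> * m" and kappa: "0 < \<kappa>"
    and RE: "AE \<omega> in M. ereal \<kappa> \<le>
          group_RE (X \<omega>) I (card (active_groups I \<beta>)) (\<alpha> / (\<alpha> - 1)) (sqrt s / (\<alpha> - 1))"
    and opt: "AE \<omega> in M. is_arg_min
          (group_lasso_objective (X \<omega>) I (y \<omega>)
             (24 * \<alpha> * \<sigma> * sqrt (1/n * ln (2 * G * exp 1 / s) * ln (2/\<delta>))
              + 4 * \<alpha> * \<sigma> * sqrt (1/n * \<gamma> * (1/s) * m)))
          (\<lambda>_. True) (\<beta>hat \<omega>)"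
  shows "with_prob_at_least M (1 - \<delta>) (\<lambda>\<omega>.
     norm (\<beta>hat \<omega> - \<beta>) \<le> 78 * (\<alpha> * \<sigma> / \<kappa> * sqrt ((s * ln (2 * G * exp 1 / s) * ln (1/\<delta>) + \<gamma> * m) / n)))"
proof -
  have s0: "0 < s" using card_active_pos[OF groups beta] unfolding s by simp
  have "card (active_groups I \<beta>) \<le> CARD('g)" by (rule card_mono) auto
  then have sG: "s \<le> G" unfolding s G by simp
  have n0: "0 < n" unfolding n by simp
  define A where "A = ln (2 * G * exp 1 / s)"
  define b where "b = ln (1 / \<delta>)"
  note L = ln_sparsity_ratio[OF s0 sG, folded A_def]
  have A: "1 \<le> A" using L by simp
  have lnb: "ln 2 \<le> b" unfolding b_def using delta by (simp add: field_simps)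
  then have b: "2/3 \<le> b" using ln2_ge_two_thirds by linarith
  have ln2d: "ln (2 / \<delta>) = ln 2 + b" using delta by (simp add: b_def ln_div)
  define U where "U = 1/n * A * (ln 2 + b)"
  define V where "V = 1/n * \<gamma> * (1/s) * m"
  define l where "l = 24 * \<alpha> * \<sigma> * sqrt U + 4 * \<alpha> * \<sigma> * sqrt V"
  \<comment> \<open>Again chosen so that \<open>2 * N * \<alpha>\<close> equals
    \<open>l * n\<close>.\<close>
  define N where "N = n * \<sigma> * (12 * sqrt U + 2 * sqrt V)"
  have U: "0 < U" unfolding U_def using n0 A b by (intro mult_pos_pos) (auto intro: add_pos_pos)
  have V: "0 \<le> V" unfolding V_def using n0 s0 gamma m by simp
  have r: "0 \<le> \<gamma> * m / s" using s0 gamma m by simp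
  have "with_prob_at_least M (1 - \<delta>) (\<lambda>\<omega>. norm (\<beta>hat \<omega> - \<beta>) \<le> 3/2 * (l * sqrt (card (active_groups I \<beta>))) / \<kappa>)"
  proof (rule group_lasso_rate[where N=N, OF model sigma delta(1) beta groups alpha kappa refl])
    show "AE \<omega> in M. \<forall>g z. (norm (X \<omega> *v restr (I g) z))\<^sup>2 \<le> CARD('n) * (norm z)\<^sup>2"
      using X by eventually_elim (simp add: norm_matrix_vector_mult_restr_SUP_le[OF groups] flip: n)
    show "AE \<omega> in M. ereal \<kappa> \<le> group_RE (X \<omega>) I (card (active_groups I \<beta>)) (\<alpha> / (\<alpha> - 1))
        (sqrt (real (card (active_groups I \<beta>))) / (\<alpha> - 1))"
      using RE unfolding s .
    show "AE \<omega> in M. is_arg_min (group_lasso_objective (X \<omega>) I (y \<omega>) l) (\<lambda>_. True) (\<beta>hat \<omega>)"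
      using opt unfolding l_def U_def V_def A_def ln2d[symmetric] .
    show "0 < N" unfolding N_def using sigma n0 U V by (intro mult_pos_pos add_pos_nonneg) auto
    show "2 * N * \<alpha> \<le> l * CARD('n)" by (simp add: N_def l_def n algebra_simps)
    have "8/3 * \<sigma>\<^sup>2 * n * (s * ln (G / (s * \<delta>)) + ln 2 * largest_total_size I (card (active_groups I \<beta>)))
        \<le> 8/3 * \<sigma>\<^sup>2 * n * (s * ln (G / (s * \<delta>)) + ln 2 * (\<gamma> * m))"
      using m0 n0 by (intro mult_left_mono add_left_mono) auto
    also have "\<dots> = \<sigma>\<^sup>2 * n * s * (8/3 * (ln (G / s) + b + ln 2 * (\<gamma> * m / s)))"
    proof -
      have "ln (G / (s * \<delta>)) = ln (G / s) + b"
        using s0 sG delta by (simp add: b_def ln_div ln_mult_pos)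
      then show ?thesis using s0 by (simp add: field_simps)
    qed
    also have "\<dots> \<le> \<sigma>\<^sup>2 * n * s * (16/25 * (144 * (A * (ln 2 + b)) + 4 * (\<gamma> * m / s)))"
      using group_lasso_noise_level[OF A b _ r, of "ln (G / s)"] L n0 s0 by (intro mult_left_mono) auto
    also have "\<dots> = s * (16/25 * (n\<^sup>2 * \<sigma>\<^sup>2 * (144 * U + 4 * V)))"
      using n0 s0 by (simp add: U_def V_def power2_eq_square[of n] field_simps)
    also have "\<dots> \<le> s * (4/5 * N)\<^sup>2"
    proof -
      \<comment> \<open>The cross term of the square is nonnegative and is dropped.\<close>
      have "144 * U + 4 * V \<le> (12 * sqrt U + 2 * sqrt V)\<^sup>2"
        using U V by (simp add: power2_sum power_mult_distrib)
      then have "n\<^sup>2 * \<sigma>\<^sup>2 * (144 * U + 4 * V) \<le> n\<^sup>2 * \<sigma>\<^sup>2 * (12 * sqrt U + 2 * sqrt V)\<^sup>2"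
        by (rule mult_left_mono) simp
      moreover have "(4/5 * N)\<^sup>2 = 16/25 * N\<^sup>2" by (simp add: power_mult_distrib power_divide)
      moreover have "N\<^sup>2 = n\<^sup>2 * \<sigma>\<^sup>2 * (12 * sqrt U + 2 * sqrt V)\<^sup>2" by (simp add: N_def power_mult_distrib)
      ultimately show ?thesis using s0 by (simp only: mult_left_mono less_imp_le)
    qed
    finally show "8/3 * \<sigma>\<^sup>2 * CARD('n) * (card (active_groups I \<beta>) * ln (CARD('g) / (card (active_groups I \<beta>) * \<delta>))
        + ln 2 * largest_total_size I (card (active_groups I \<beta>))) \<le> card (active_groups I \<beta>) * (4/5 * N)\<^sup>2"
      unfolding n G s .
  qed
  moreover have "3/2 * (l * sqrt (card (active_groups I \<beta>))) / \<kappa> \<le> 78 * (\<alpha> * \<sigma> / \<kappa> * sqrt ((s * A * b + \<gamma> * m) / n))"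
  proof -
    define T where "T = (s * A * b + \<gamma> * m) / n"
    have "sqrt U * sqrt s = sqrt (s * A * (ln 2 + b) / n)"
      by (simp add: U_def mult_ac flip: real_sqrt_mult)
    also have "\<dots> \<le> sqrt (4 * T)"
    proof (rule real_sqrt_le_mono)
      \<comment> \<open>Since \<open>\<delta> < 1/2\<close>, \<open>ln 2\<close> is at most
        \<open>b\<close>; this trades \<open>ln (2 / \<delta>)\<close> for
        \<open>ln (1 / \<delta>)\<close>. The generous 4 has an integer root.\<close>
      have "s * A * (ln 2 + b) \<le> s * A * (4 * b)" using lnb b s0 A by (intro mult_left_mono) auto
      also have "\<dots> \<le> 4 * (s * A * b + \<gamma> * m)" using gamma m by simp
      finally have "s * A * (ln 2 + b) / n \<le> 4 * (s * A * b + \<gamma> * m) / n"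
        by (rule divide_right_mono) (use n0 in simp)
      then show "s * A * (ln 2 + b) / n \<le> 4 * T" by (simp add: T_def)
    qed
    finally have 1: "sqrt U * sqrt s \<le> 2 * sqrt T" by (simp add: real_sqrt_mult)
    have "sqrt V * sqrt s = sqrt (\<gamma> * m / n)"
      using s0 by (simp add: V_def flip: real_sqrt_mult)
    also have "\<dots> \<le> sqrt T"
      unfolding T_def using s0 A b n0 by (intro real_sqrt_le_mono divide_right_mono) auto
    finally have 2: "sqrt V * sqrt s \<le> sqrt T" .
    have "3/2 * (l * sqrt s) / \<kappa> = \<alpha> * \<sigma> / \<kappa> * (36 * (sqrt U * sqrt s) + 6 * (sqrt V * sqrt s))"
      using kappa by (simp add: l_def field_simps)
    \<comment> \<open>The constant is \<open>36 * 2 + 6 = 78\<close>.\<close>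
    also have "\<dots> \<le> \<alpha> * \<sigma> / \<kappa> * (78 * sqrt T)"
      using 1 2 alpha sigma kappa by (intro mult_left_mono) auto
    finally show ?thesis by (simp add: T_def s)
  qed
  ultimately show ?thesis unfolding A_def b_def with_prob_at_least_def by (meson order_trans)
qed

text \<open>For \<open>k = p\<close> the Lasso bound in \<open>ln (p / k)\<close> would be zero,
  that is, it would claim exact recovery; hence the condition \<open>2 * k \<le> p\<close>. The
  companion bound keeps the full logarithm and holds for all sparsity levels, on the same event. A
  nonzero \<open>\<beta>\<close> makes the denominators \<open>k\<close> and \<open>s\<close>
  positive.\<close>

theorem theorem2:
  fixes M :: "'w measure"
    and X :: "'w \<Rightarrow> real^'p::finite^'n::finite"
    and y \<epsilon> :: "'w \<Rightarrow> real^'n"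
    and \<beta> :: "real^'p"
    and I :: "'g::finite \<Rightarrow> 'p set"
    and \<sigma> \<delta> \<alpha> n p k G s m :: real
  assumes model: "sub_gaussian_linear_model M X y \<beta> \<epsilon> \<sigma>"
    and sigma: "\<sigma> > 0"
    and beta: "\<beta> \<noteq> 0"
    and groups: "group_partition I"
    and delta: "0 < \<delta>" "\<delta> < 1/2"
    and alpha: "\<alpha> \<ge> 2"
    and n: "n = real CARD('n)"
    and p: "p = real CARD('p)"
    and k: "k = real (card (supp \<beta>))"
    and G: "G = real CARD('g)"
    and s: "s = real (card (active_groups I \<beta>))"
    and m: "m = real (total_size I (active_groups I \<beta>))"
  shows
   "(\<forall>\<kappa> \<beta>hat.
       (AE \<omega> in M. \<forall>j. norm (column j (X \<omega>)) \<le> sqrt n) \<and>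
       0 < \<kappa> \<and>
       (AE \<omega> in M. ereal \<kappa> \<le>
          lasso_RE (X \<omega>) (card (supp \<beta>)) (\<alpha> / (\<alpha> - 1)) (sqrt k / (\<alpha> - 1))) \<and>
       (AE \<omega> in M. is_arg_min
          (lasso_objective (X \<omega>) (y \<omega>)
             (24 * \<alpha> * \<sigma> * sqrt (1/n * ln (2 * p * exp 1 / k) * ln (1/\<delta>))))
          (\<lambda>_. True) (\<beta>hat \<omega>))
       \<longrightarrow>
       with_prob_at_least M (1 - \<delta>) (\<lambda>\<omega>.
          (2 * k \<le> p \<longrightarrow>
             norm (\<beta>hat \<omega> - \<beta>) \<lesssim> \<alpha> * \<sigma> / \<kappa> * sqrt (k * ln (p / k) * ln (1/\<delta>) / n)) \<and>
          norm (\<beta>hat \<omega> - \<beta>) \<lesssim> \<alpha> * \<sigma> / \<kappa> * sqrt (k * ln (2 * p * exp 1 / k) * ln (1/\<delta>) / n)))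
    \<and>
    (\<forall>\<gamma> \<kappa> \<beta>hat.
       (AE \<omega> in M. (SUP g. mu_max (X \<omega>) (I g)) \<le> n) \<and>
       1 \<le> \<gamma> \<and>
       real (largest_total_size I (card (active_groups I \<beta>))) \<le> \<gamma> * m \<and>
       0 < \<kappa> \<and>
       (AE \<omega> in M. ereal \<kappa> \<le>
          group_RE (X \<omega>) I (card (active_groups I \<beta>)) (\<alpha> / (\<alpha> - 1)) (sqrt s / (\<alpha> - 1))) \<and>
       (AE \<omega> in M. is_arg_min
          (group_lasso_objective (X \<omega>) I (y \<omega>)
             (24 * \<alpha> * \<sigma> * sqrt (1/n * ln (2 * G * exp 1 / s) * ln (2/\<delta>))
              + 4 * \<alpha> * \<sigma> * sqrt (1/n * \<gamma> * (1/s) * m)))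
          (\<lambda>_. True) (\<beta>hat \<omega>))
       \<longrightarrow>
       with_prob_at_least M (1 - \<delta>) (\<lambda>\<omega>.
          (2 * s \<le> G \<longrightarrow>
             norm (\<beta>hat \<omega> - \<beta>) \<lesssim> \<alpha> * \<sigma> / \<kappa> * sqrt ((s * ln (G / s) * ln (1/\<delta>) + \<gamma> * m) / n)) \<and>
          norm (\<beta>hat \<omega> - \<beta>) \<lesssim>
             \<alpha> * \<sigma> / \<kappa> * sqrt ((s * ln (2 * G * exp 1 / s) * ln (1/\<delta>) + \<gamma> * m) / n)))"
proof (intro conjI allI impI; elim conjE)
  have s0: "0 < s" using card_active_pos[OF groups beta] unfolding s by simp
  have k0: "0 < k"
    using card_active_pos[OF group_partition_singletons beta] unfolding k active_groups_singletons by simp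
  have b0: "0 \<le> ln (1 / \<delta>)" using delta by simp
  have kp: "k \<le> p" "s \<le> G" unfolding k p s G by (auto intro!: card_mono)
  have n0: "0 < n" by (simp add: n)
  {
    fix \<kappa> \<beta>hat
    assume X: "AE \<omega> in M. \<forall>j. norm (column j (X \<omega>)) \<le> sqrt n" and kappa: "0 < \<kappa>"
      and RE: "AE \<omega> in M. ereal \<kappa> \<le>
          lasso_RE (X \<omega>) (card (supp \<beta>)) (\<alpha> / (\<alpha> - 1)) (sqrt k / (\<alpha> - 1))"
      and opt: "AE \<omega> in M. is_arg_min
          (lasso_objective (X \<omega>) (y \<omega>)
             (24 * \<alpha> * \<sigma> * sqrt (1/n * ln (2 * p * exp 1 / k) * ln (1/\<delta>))))
          (\<lambda>_. True) (\<beta>hat \<omega>)"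
    define T where "T = k * ln (2 * p * exp 1 / k) * ln (1/\<delta>) / n"
    define T' where "T' = k * ln (p / k) * ln (1/\<delta>) / n"
    define c where "c = \<alpha> * \<sigma> / \<kappa>"
    have c: "0 \<le> c" using alpha sigma kappa by (simp add: c_def)
    have T: "0 \<le> T" using k0 kp n0 b0 ln_sparsity_ratio[OF k0 kp(1)] by (simp add: T_def)
    have TT': "sqrt T \<le> 2 * sqrt T'" if "2 * k \<le> p"
    proof -
      have "k * ln (2 * p * exp 1 / k) * ln (1/\<delta>) / n \<le> k * (4 * ln (p / k)) * ln (1/\<delta>) / n"
        using ln_sparsity_ratio_le[OF k0 that] k0 b0 n0
        by (intro divide_right_mono mult_right_mono mult_left_mono) auto
      then have "T \<le> 4 * T'" by (simp add: T_def T'_def mult_ac)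
      then have "sqrt T \<le> sqrt (4 * T')" by (rule real_sqrt_le_mono)
      then show ?thesis by (simp add: real_sqrt_mult)
    qed
    have "with_prob_at_least M (1 - \<delta>) (\<lambda>\<omega>. norm (\<beta>hat \<omega> - \<beta>) \<le> 36 * (c * sqrt T))"
      unfolding c_def T_def
      by (rule lasso_rate[OF model sigma beta delta alpha n p k X kappa RE opt])
    then show "with_prob_at_least M (1 - \<delta>) (\<lambda>\<omega>.
          (2 * k \<le> p \<longrightarrow>
             norm (\<beta>hat \<omega> - \<beta>) \<lesssim> \<alpha> * \<sigma> / \<kappa> * sqrt (k * ln (p / k) * ln (1/\<delta>) / n)) \<and>
          norm (\<beta>hat \<omega> - \<beta>) \<lesssim> \<alpha> * \<sigma> / \<kappa> * sqrt (k * ln (2 * p * exp 1 / k) * ln (1/\<delta>) / n))"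
      \<comment> \<open>The constants are 36 with the full logarithm and 72 with
        \<open>ln (p / k)\<close>, both below 1000.\<close>
      using mult_left_mono[OF TT' c] mult_nonneg_nonneg[OF c real_sqrt_ge_zero[OF T]]
      unfolding with_prob_at_least_def lesssim_def T_def[symmetric] T'_def[symmetric] c_def[symmetric]
      by fastforce
  }
  {
    fix \<gamma> \<kappa> \<beta>hat
    assume X: "AE \<omega> in M. (SUP g. mu_max (X \<omega>) (I g)) \<le> n" and gamma: "1 \<le> \<gamma>"
      and m0: "real (largest_total_size I (card (active_groups I \<beta>))) \<le> \<gamma> * m" and kappa: "0 < \<kappa>"
      and RE: "AE \<omega> in M. ereal \<kappa> \<le>
          group_RE (X \<omega>) I (card (active_groups I \<beta>)) (\<alpha> / (\<alpha> - 1)) (sqrt s / (\<alpha> - 1))"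
      and opt: "AE \<omega> in M. is_arg_min
          (group_lasso_objective (X \<omega>) I (y \<omega>)
             (24 * \<alpha> * \<sigma> * sqrt (1/n * ln (2 * G * exp 1 / s) * ln (2/\<delta>))
              + 4 * \<alpha> * \<sigma> * sqrt (1/n * \<gamma> * (1/s) * m)))
          (\<lambda>_. True) (\<beta>hat \<omega>)"
    define T where "T = (s * ln (2 * G * exp 1 / s) * ln (1/\<delta>) + \<gamma> * m) / n"
    define T' where "T' = (s * ln (G / s) * ln (1/\<delta>) + \<gamma> * m) / n"
    define c where "c = \<alpha> * \<sigma> / \<kappa>"
    have c: "0 \<le> c" using alpha sigma kappa by (simp add: c_def)
    have m': "0 \<le> m" by (simp add: m)
    have T: "0 \<le> T" using s0 kp n0 b0 m' gamma ln_sparsity_ratio[OF s0 kp(2)] by (simp add: T_def)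
    have TT': "sqrt T \<le> 2 * sqrt T'" if "2 * s \<le> G"
    proof -
      have "s * ln (2 * G * exp 1 / s) * ln (1/\<delta>) \<le> s * (4 * ln (G / s)) * ln (1/\<delta>)"
        using ln_sparsity_ratio_le[OF s0 that] s0 b0
        by (intro mult_right_mono mult_left_mono) auto
      moreover have "\<gamma> * m \<le> 4 * (\<gamma> * m)" using gamma m' by simp
      ultimately have "T \<le> 4 * T'" using n0 by (simp add: T_def T'_def divide_right_mono)
      then have "sqrt T \<le> sqrt (4 * T')" by (rule real_sqrt_le_mono)
      then show ?thesis by (simp add: real_sqrt_mult)
    qed
    have "with_prob_at_least M (1 - \<delta>) (\<lambda>\<omega>. norm (\<beta>hat \<omega> - \<beta>) \<le> 78 * (c * sqrt T))"
      unfolding c_def T_def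
      by (rule group_rate[OF model sigma beta groups delta alpha n G s m' X gamma m0 kappa RE opt])
    then show "with_prob_at_least M (1 - \<delta>) (\<lambda>\<omega>.
          (2 * s \<le> G \<longrightarrow>
             norm (\<beta>hat \<omega> - \<beta>) \<lesssim> \<alpha> * \<sigma> / \<kappa> * sqrt ((s * ln (G / s) * ln (1/\<delta>) + \<gamma> * m) / n)) \<and>
          norm (\<beta>hat \<omega> - \<beta>) \<lesssim>
             \<alpha> * \<sigma> / \<kappa> * sqrt ((s * ln (2 * G * exp 1 / s) * ln (1/\<delta>) + \<gamma> * m) / n))"
      \<comment> \<open>The constants are 78 and 156 here.\<close>
      using mult_left_mono[OF TT' c] mult_nonneg_nonneg[OF c real_sqrt_ge_zero[OF T]]
      unfolding with_prob_at_least_def lesssim_def T_def[symmetric] T'_def[symmetric] c_def[symmetric]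
      by fastforce
  }
qed

end
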